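(* Let $\lambda,\gamma\in\mathbb{C}$. The Gegenbauer generating functions $$\sum_{n=0}^\infty \frac{(\gamma)_n(2\lambda-\gamma)_n}{(2\lambda)_n(\lambda+1/2)_n}\,C_n^\lambda(x)\,t^n,\qquad \sum_{n=0}^\infty {}_3F_2\!\left({{-n,\,\gamma,\,2\lambda-\gamma}\atop{2\lambda,\,\lambda+1/2}}\,\bigg|\,u\right)C_n^\lambda(x)\,t^n$$ are algebraic (1) if $\lambda\in\mathbb{Z}\pm\frac14$ with $\gamma-\lambda\in\mathbb{Z}\pm\frac13$; or (2) if $\lambda\in\mathbb{Z}\pm\frac16$ with $\gamma-\lambda\in\mathbb{Z}\pm\{\frac13,\frac14\}$. In the latter generating function, $u$ is arbitrary: the algebraicity is in $x,t$ and $u$.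
   Context: For $\lambda\in\mathbb{C}$ the Gegenbauer polynomials $C_n^\lambda(x)$, $n=0,1,2,\dots$, are defined by $\sum_{n=0}^\infty C_n^\lambda(x)t^n=(1-2xt+t^2)^{-\lambda}$ (as a power series in $t$ with constant term $1$). $(a)_n=a(a+1)\cdots(a+n-1)$ is the Pochhammer symbol, and ${}_3F_2$ is the generalized hypergeometric series (here terminating because of the upper parameter $-n$, hence a polynomial in $u$). The notation $\mathbb{Z}\pm a$ means the set of all numbers differing from an integer by $a$ or $-a$, and $\mathbb{Z}\pm\{a,b\}=(\mathbb{Z}\pm a)\cup(\mathbb{Z}\pm b)$; all sign choices are independent. "Algebraic" means that the power series in $t$ defines an algebraic function of its arguments ($t,x$ for the first generating function; $t,x,u$ for the second). *)

theory Defs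
  imports "HOL-Complex_Analysis.Complex_Analysis" "HOL-Computational_Algebra.Computational_Algebra"
begin

text \<open>
  The binomial series \<open>(1 + z)\<close> to the power \<open>-\<lambda>\<close>, with its coefficients regarded as constant
  polynomials in \<open>x\<close>, is composed with \<open>z = t\<^sup>2 - 2 x t\<close>; here \<open>fps_X\<close> is \<open>t\<close> and \<open>[:0, 1:]\<close> is \<open>x\<close>.
\<close>

definition gegenbauer_gf :: "complex \<Rightarrow> complex poly fps" where
  "gegenbauer_gf l =
     Abs_fps (\<lambda>k. [:fps_nth (fps_binomial (- l)) k:])
       oo (fps_X ^ 2 - fps_const (2 * [:0, 1:]) * fps_X)"

definition gegenbauer :: "complex \<Rightarrow> nat \<Rightarrow> complex poly" where
  "gegenbauer l n = fps_nth (gegenbauer_gf l) n"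

lemma gegenbauer_fps:
  "Abs_fps (\<lambda>n. poly (gegenbauer l n) x) =
     fps_binomial (- l) oo (fps_X ^ 2 - fps_const (2 * x) * fps_X)"
proof -
  define B :: "complex poly fps" where "B = fps_X ^ 2 - fps_const (2 * [:0, 1:]) * fps_X"
  define b :: "complex fps" where "b = fps_X ^ 2 - fps_const (2 * x) * fps_X"
  have B0: "poly (fps_nth B n) x = fps_nth b n" for n
    by (simp add: B_def b_def fps_X_power_iff)
  have "poly (fps_nth (B ^ i) n) x = fps_nth (b ^ i) n" for i n
    by (induction i arbitrary: n) (simp_all add: fps_mult_nth poly_sum B0)
  then show ?thesis
    unfolding gegenbauer_def gegenbauer_gf_def B_def [symmetric] b_def [symmetric]
    by (simp add: fps_eq_iff fps_compose_nth poly_sum)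
qed

lemma gegenbauer_has_fps_expansion:
  "(\<lambda>t. (1 - 2 * x * t + t ^ 2) powr (- l)) has_fps_expansion
     Abs_fps (\<lambda>n. poly (gegenbauer l n) x)"
proof -
  have "(\<lambda>t. t ^ 2 - 2 * x * t) has_fps_expansion (fps_X ^ 2 - fps_const (2 * x) * fps_X)"
    by (intro fps_expansion_intros)
  then have "((\<lambda>z. (1 + z) powr (- l)) \<circ> (\<lambda>t. t ^ 2 - 2 * x * t)) has_fps_expansion
      (fps_binomial (- l) oo (fps_X ^ 2 - fps_const (2 * x) * fps_X))"
    by (intro has_fps_expansion_compose has_fps_expansion_binomial_complex) auto
  then show ?thesis
    by (simp add: gegenbauer_fps o_def algebra_simps)
qed

text \<open>
  The series with upper parameters \<open>-n, a, b\<close> and lower parameters \<open>c, d\<close> as a polynomial in its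
  argument.  The truncation drops only zero terms.
\<close>

definition hyp_3F2_poly :: "nat \<Rightarrow> complex \<Rightarrow> complex \<Rightarrow> complex \<Rightarrow> complex \<Rightarrow> complex poly" where
  "hyp_3F2_poly n a b c d = truncate_fps (Suc n) (fps_hypergeo [- of_nat n, a, b] [c, d] 1)"

lemma fps_of_hyp_3F2_poly:
  "fps_of_poly (hyp_3F2_poly n a b c d) = fps_hypergeo [- of_nat n, a, b] [c, d] 1"
  by (rule fps_ext) (auto simp: hyp_3F2_poly_def coeff_truncate_fps pochhammer_of_nat_eq_0_iff)

text \<open>
  With \<open>R\<close> the ring of polynomials over \<open>\<complex>\<close> in the remaining variables, a series in \<open>R[[t]]\<close> is
  an algebraic function of \<open>t\<close> and these variables iff it is a root of a nonzero polynomial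
  over \<open>R[t]\<close> (equivalently, after clearing denominators, over its fraction field).
\<close>

definition algebraic_fps :: "'a :: idom fps \<Rightarrow> bool" where
  "algebraic_fps F \<longleftrightarrow> (\<exists>P :: 'a poly poly. P \<noteq> 0 \<and> poly (map_poly fps_of_poly P) F = 0)"

definition Ints_pm :: "complex \<Rightarrow> complex set" where
  "Ints_pm a = {z. \<exists>k :: int. z = of_int k + a \<or> z = of_int k - a}"

text \<open>
  The second series has coefficients in \<open>\<complex>[x][u]\<close>: the outer polynomial variable is \<open>u\<close>, and the
  Gegenbauer polynomial in \<open>x\<close> is a scalar.
\<close>

definition gegenbauer_series1 :: "complex \<Rightarrow> complex \<Rightarrow> complex poly fps" where
  "gegenbauer_series1 l g = Abs_fps (\<lambda>n.
     smult (pochhammer g n * pochhammer (2 * l - g) n /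
            (pochhammer (2 * l) n * pochhammer (l + 1 / 2) n))
       (gegenbauer l n))"

definition gegenbauer_series2 :: "complex \<Rightarrow> complex \<Rightarrow> complex poly poly fps" where
  "gegenbauer_series2 l g = Abs_fps (\<lambda>n.
     smult (gegenbauer l n)
       (map_poly (\<lambda>c. [:c:]) (hyp_3F2_poly n g (2 * l - g) (2 * l) (l + 1 / 2))))"

end

theory Submission
  imports Defs
begin

text \<open>
  Let \<open>F\<close> be the hypergeometric series with upper parameters \<open>g, 2 l - g\<close> and lower parameter
  \<open>l + 1/2\<close>. Brafman's formula factors the first generating function: with \<open>S\<^sup>2 = 1 - 2 x t + t\<^sup>2\<close> it is
  \<open>F((1 - S - t) / 2) F((1 - S + t) / 2)\<close>. The second one reduces to the first. Expanding the
  hypergeometric polynomial in powers of \<open>u\<close> and summing over \<open>n\<close> first, one meets the Taylor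
  coefficients of the Gegenbauer generating function in the direction of \<open>t\<close>, which are again
  Gegenbauer polynomials. With \<open>R\<^sup>2 = 1 - 2 x t + t\<^sup>2\<close>, the second series is \<open>R\<close> to the power \<open>-2 l\<close>
  times the first one at \<open>((x - t) / R, - u t / R)\<close>. As \<open>l\<close> is rational, both series are algebraic
  once \<open>F\<close> is.

  Brafman's formula (\<open>brafman\<close>) is an identity between power series in the two arguments \<open>y, z\<close>
  of \<open>F\<close>. The polynomials \<open>t\<^sup>n C\<^sub>n(x)\<close> are polynomials in \<open>y\<close> and \<open>z\<close>, and a partial differential equation
  for their generating function (\<open>geg_hom_pde\<close>) gives a recursion for their coefficients. The recursion
  turns into that of the coefficients of \<open>F(y)\<close> when it is summed with the weights of the first series.

  For the parameters in question the exponent differences of the hypergeometric equation for \<open>F\<close>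
  at \<open>0, 1, \<infinity>\<close> are \<open>(1/4, 1/4, 2/3)\<close>, \<open>(1/3, 1/3, 2/3)\<close> or \<open>(1/3, 1/3, 1/2)\<close> up to signs and integers.
  These belong to Schwarz's list, with octahedral or tetrahedral projective monodromy. Contiguity
  (\<open>algebraic_hyp2F1_shift\<close>) shows that algebraicity depends only on the parameters modulo \<open>\<int>\<close>, and
  six triples of parameters remain. For each of them there are a rational function \<open>\<phi>\<close> and an
  explicit product \<open>h\<close> of powers of polynomials with \<open>F \<circ> \<phi> = h\<close>; the lemma
  \<open>algebraic_hyp2F1_pullback\<close> reduces this relation to polynomial identities.

  All this needs that algebraic series are closed under the ring operations, cancellation of
  factors, composition and differentiation. The basis is transitivity of algebraic dependence
  (\<open>alg_trans\<close>), proved by linear algebra over a subring of a domain.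
\<close>

section \<open>Elements algebraic over a subring of a domain\<close>

text \<open>
  A homogeneous system with fewer equations than unknowns. The elimination step multiplies instead of
  dividing, so that the solution stays in the subring.
\<close>

lemma homogeneous_system_solvable:
  fixes v :: "'i \<Rightarrow> 'j \<Rightarrow> 'a :: idom"
  assumes S: "1 \<in> S" "\<And>x y. x \<in> S \<Longrightarrow> y \<in> S \<Longrightarrow> x - y \<in> S"
             "\<And>x y. x \<in> S \<Longrightarrow> y \<in> S \<Longrightarrow> x * y \<in> S"
    and "finite J" "finite I" "card J < card I" "\<And>i j. i \<in> I \<Longrightarrow> j \<in> J \<Longrightarrow> v i j \<in> S"
  shows "\<exists>c. (\<forall>i\<in>I. c i \<in> S) \<and> (\<exists>i\<in>I. c i \<noteq> 0) \<and> (\<forall>j\<in>J. (\<Sum>i\<in>I. c i * v i j) = 0)"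
  using assms(4-)
proof (induction J arbitrary: I v rule: finite_induct)
  case empty
  then obtain i where "i \<in> I" by fastforce
  then show ?case using S(1) by (intro exI[of _ "\<lambda>_. 1"]) auto
next
  case (insert j J)
  have z: "0 \<in> S" using S(2)[OF S(1) S(1)] by simp
  have sumS: "(\<Sum>i\<in>A. f i) \<in> S" if "finite A" "\<And>i. i \<in> A \<Longrightarrow> f i \<in> S" for A and f :: "'i \<Rightarrow> 'a"
    using that
  proof (induction A rule: finite_induct)
    case (insert a A)
    have "sum f A \<in> S" using insert by auto
    then have "f a - (0 - sum f A) \<in> S" using insert by (intro S(2) z) auto
    then show ?case using insert by simp
  qed (simp add: z)
  show ?case
  proof (cases "\<forall>i\<in>I. v i j = 0")
    case True
    have "\<exists>c. (\<forall>i\<in>I. c i \<in> S) \<and> (\<exists>i\<in>I. c i \<noteq> 0) \<and> (\<forall>j\<in>J. (\<Sum>i\<in>I. c i * v i j) = 0)"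
      using insert.prems insert.hyps by (intro insert.IH) auto
    then show ?thesis using True by auto
  next
    case False
    then obtain k where k: "k \<in> I" "v k j \<noteq> 0" by auto
    \<comment> \<open>Eliminate with the pivot \<open>v k j\<close>.\<close>
    define I' where "I' = I - {k}"
    define v' where "v' = (\<lambda>i m. v k j * v i m - v i j * v k m)"
    have "\<exists>c. (\<forall>i\<in>I'. c i \<in> S) \<and> (\<exists>i\<in>I'. c i \<noteq> 0) \<and> (\<forall>m\<in>J. (\<Sum>i\<in>I'. c i * v' i m) = 0)"
      using insert.prems insert.hyps k
      by (intro insert.IH) (auto simp: I'_def v'_def intro!: S(2,3))
    then obtain c where c: "\<And>i. i \<in> I' \<Longrightarrow> c i \<in> S" "\<exists>i\<in>I'. c i \<noteq> 0"
        "\<And>m. m \<in> J \<Longrightarrow> (\<Sum>i\<in>I'. c i * v' i m) = 0" by blast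
    define d where "d = (\<lambda>i. if i = k then 0 - (\<Sum>i\<in>I'. c i * v i j) else c i * v k j)"
    have fin: "finite I'" using insert.prems by (simp add: I'_def)
    have eq: "(\<Sum>i\<in>I. d i * v i m) = (\<Sum>i\<in>I'. c i * v' i m)" for m
    proof -
      have "(\<Sum>i\<in>I. d i * v i m) = d k * v k m + (\<Sum>i\<in>I'. d i * v i m)"
        unfolding I'_def by (intro sum.remove) (use insert.prems k in auto)
      also have "(\<Sum>i\<in>I'. d i * v i m) = (\<Sum>i\<in>I'. c i * v k j * v i m)"
        by (intro sum.cong) (auto simp: d_def I'_def)
      also have "d k * v k m + \<dots> = (\<Sum>i\<in>I'. c i * v' i m)"
        by (simp add: d_def v'_def sum_distrib_left sum_subtractf algebra_simps)
      finally show ?thesis .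
    qed
    have "v' i j = 0" for i by (simp add: v'_def)
    then have "(\<Sum>i\<in>I. d i * v i m) = 0" if "m \<in> insert j J" for m
      using that c(3) by (auto simp: eq)
    moreover have "d i \<in> S" if "i \<in> I" for i
    proof (cases "i = k")
      case True
      have "(\<Sum>i\<in>I'. c i * v i j) \<in> S"
        using c(1) insert.prems fin by (intro sumS S(3)) (auto simp: I'_def)
      then have "0 - (\<Sum>i\<in>I'. c i * v i j) \<in> S" by (intro S(2) z)
      then show ?thesis using True by (simp add: d_def)
    next
      case False
      then show ?thesis using that c(1) k insert.prems by (auto simp: d_def I'_def intro!: S(3))
    qed
    moreover have "\<exists>i\<in>I. d i \<noteq> 0"
      using c(2) k by (auto simp: d_def I'_def)
    ultimately show ?thesis by blast
  qed
qed

locale subdomain =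
  fixes S :: "'a :: idom set"
  assumes one_mem: "1 \<in> S"
    and diff_mem: "\<And>x y. x \<in> S \<Longrightarrow> y \<in> S \<Longrightarrow> x - y \<in> S"
    and mult_mem: "\<And>x y. x \<in> S \<Longrightarrow> y \<in> S \<Longrightarrow> x * y \<in> S"
begin

lemma zero_mem: "0 \<in> S"
  using diff_mem[OF one_mem one_mem] by simp

lemma uminus_mem: "x \<in> S \<Longrightarrow> - x \<in> S"
  using diff_mem[OF zero_mem, of x] by simp

lemma add_mem: "x \<in> S \<Longrightarrow> y \<in> S \<Longrightarrow> x + y \<in> S"
  using diff_mem[of x "- y"] uminus_mem by simp

definition alg :: "'a \<Rightarrow> bool" where
  "alg x \<longleftrightarrow> (\<exists>p. p \<noteq> 0 \<and> (\<forall>i. coeff p i \<in> S) \<and> poly p x = 0)"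

text \<open>
  The span of \<open>W\<close> over the fraction field of \<open>S\<close>, intersected with the ambient domain: allowing a
  denominator \<open>d\<close> gives linear algebra over a field without leaving the domain.
\<close>

definition frac_span :: "'a set \<Rightarrow> 'a set" where
  "frac_span W = {v. \<exists>d c. d \<in> S \<and> d \<noteq> 0 \<and> (\<forall>w\<in>W. c w \<in> S) \<and> d * v = (\<Sum>w\<in>W. c w * w)}"

lemma frac_spanI:
  "d \<in> S \<Longrightarrow> d \<noteq> 0 \<Longrightarrow> (\<And>w. w \<in> W \<Longrightarrow> c w \<in> S) \<Longrightarrow> d * v = (\<Sum>w\<in>W. c w * w) \<Longrightarrow> v \<in> frac_span W"
  unfolding frac_span_def by blast

lemma frac_spanE:
  assumes "v \<in> frac_span W"
  obtains d c where "d \<in> S" "d \<noteq> 0" "\<And>w. w \<in> W \<Longrightarrow> c w \<in> S" "d * v = (\<Sum>w\<in>W. c w * w)"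
  using assms unfolding frac_span_def by blast

lemma frac_span_zero: "0 \<in> frac_span W"
  by (rule frac_spanI[of 1 _ "\<lambda>_. 0"]) (auto intro: one_mem zero_mem)

lemma frac_span_base: "finite W \<Longrightarrow> w \<in> W \<Longrightarrow> w \<in> frac_span W"
  by (rule frac_spanI[of 1 _ "\<lambda>v. if v = w then 1 else 0"])
     (auto intro: one_mem zero_mem simp: if_distrib[of "\<lambda>x. x * _"] sum.delta cong: if_cong)

lemma frac_span_add:
  assumes "u \<in> frac_span W" "v \<in> frac_span W"
  shows "u + v \<in> frac_span W"
proof -
  obtain d c where d: "d \<in> S" "d \<noteq> 0" "\<And>w. w \<in> W \<Longrightarrow> c w \<in> S" "d * u = (\<Sum>w\<in>W. c w * w)"
    using frac_spanE[OF assms(1)] by blast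
  obtain d' c' where d': "d' \<in> S" "d' \<noteq> 0" "\<And>w. w \<in> W \<Longrightarrow> c' w \<in> S" "d' * v = (\<Sum>w\<in>W. c' w * w)"
    using frac_spanE[OF assms(2)] by blast
  have "d * d' * (u + v) = d' * (d * u) + d * (d' * v)" by (simp add: algebra_simps)
  also have "\<dots> = (\<Sum>w\<in>W. (d' * c w + d * c' w) * w)"
    by (simp add: d d' sum_distrib_left sum.distrib algebra_simps)
  finally show ?thesis
    using d d' by (intro frac_spanI[of "d * d'"]) (auto intro: mult_mem add_mem)
qed

lemma frac_span_scale:
  assumes "s \<in> S" "v \<in> frac_span W"
  shows "s * v \<in> frac_span W"
proof -
  obtain d c where d: "d \<in> S" "d \<noteq> 0" "\<And>w. w \<in> W \<Longrightarrow> c w \<in> S" "d * v = (\<Sum>w\<in>W. c w * w)"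
    using frac_spanE[OF assms(2)] by blast
  have "d * (s * v) = s * (d * v)" by (simp add: algebra_simps)
  also have "\<dots> = (\<Sum>w\<in>W. (s * c w) * w)"
    by (simp add: d sum_distrib_left algebra_simps)
  finally show ?thesis
    using d assms by (intro frac_spanI[of d]) (auto intro: mult_mem)
qed

lemma frac_span_cancel:
  assumes "s \<in> S" "s \<noteq> 0" "s * v \<in> frac_span W"
  shows "v \<in> frac_span W"
proof -
  obtain d c where d: "d \<in> S" "d \<noteq> 0" "\<And>w. w \<in> W \<Longrightarrow> c w \<in> S" "d * (s * v) = (\<Sum>w\<in>W. c w * w)"
    using frac_spanE[OF assms(3)] by blast
  then show ?thesis using assms
    by (intro frac_spanI[of "d * s" W c]) (auto intro: mult_mem simp: mult_ac)
qed

lemma frac_span_sum: "(\<And>i. i \<in> A \<Longrightarrow> f i \<in> frac_span W) \<Longrightarrow> sum f A \<in> frac_span W"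
  by (induction A rule: infinite_finite_induct) (auto intro: frac_span_zero frac_span_add)

lemma frac_span_mult:
  assumes "\<And>u v. u \<in> U \<Longrightarrow> v \<in> V \<Longrightarrow> u * v \<in> frac_span W" "x \<in> frac_span U" "y \<in> frac_span V"
  shows "x * y \<in> frac_span W"
proof -
  obtain d c where d: "d \<in> S" "d \<noteq> 0" "\<And>w. w \<in> U \<Longrightarrow> c w \<in> S" "d * x = (\<Sum>w\<in>U. c w * w)"
    using frac_spanE[OF assms(2)] by blast
  obtain d' c' where d': "d' \<in> S" "d' \<noteq> 0" "\<And>w. w \<in> V \<Longrightarrow> c' w \<in> S" "d' * y = (\<Sum>w\<in>V. c' w * w)"
    using frac_spanE[OF assms(3)] by blast
  have "(d * d') * (x * y) = (d * x) * (d' * y)" by (simp add: algebra_simps)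
  also have "\<dots> = (\<Sum>u\<in>U. \<Sum>v\<in>V. (c u * c' v) * (u * v))"
    unfolding d d' sum_product by (intro sum.cong refl) (simp add: mult_ac)
  also have "\<dots> \<in> frac_span W"
    by (intro frac_span_sum frac_span_scale mult_mem d d' assms(1))
  finally show ?thesis
    using d(2) d'(2) frac_span_cancel[OF mult_mem[OF d(1) d'(1)]] by simp
qed

definition finite_algebra :: "'a set \<Rightarrow> bool" where
  "finite_algebra M \<longleftrightarrow>
     (\<exists>W. finite W \<and> M = frac_span W) \<and> 1 \<in> M \<and> (\<forall>x\<in>M. \<forall>y\<in>M. x * y \<in> M)"

lemma finite_algebra_closed:
  assumes "finite_algebra M"
  shows "1 \<in> M" "0 \<in> M" "\<And>x y. x \<in> M \<Longrightarrow> y \<in> M \<Longrightarrow> x * y \<in> M"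
    "\<And>x y. x \<in> M \<Longrightarrow> y \<in> M \<Longrightarrow> x + y \<in> M" "S \<subseteq> M" "\<And>x. x \<in> M \<Longrightarrow> - x \<in> M"
    "\<And>x n. x \<in> M \<Longrightarrow> x ^ n \<in> M" "\<And>x s. s \<in> S \<Longrightarrow> s \<noteq> 0 \<Longrightarrow> s * x \<in> M \<Longrightarrow> x \<in> M"
proof -
  obtain W where W: "finite W" "M = frac_span W" using assms unfolding finite_algebra_def by blast
  show 1: "1 \<in> M" and m: "\<And>x y. x \<in> M \<Longrightarrow> y \<in> M \<Longrightarrow> x * y \<in> M"
    using assms unfolding finite_algebra_def by auto
  show "0 \<in> M" "\<And>x y. x \<in> M \<Longrightarrow> y \<in> M \<Longrightarrow> x + y \<in> M"
       "\<And>x s. s \<in> S \<Longrightarrow> s \<noteq> 0 \<Longrightarrow> s * x \<in> M \<Longrightarrow> x \<in> M"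
    using W frac_span_zero frac_span_add frac_span_cancel by auto
  show S: "S \<subseteq> M" using 1 W frac_span_scale[of _ 1 W] by auto
  show "- x \<in> M" if "x \<in> M" for x
    using that W frac_span_scale[OF uminus_mem[OF one_mem], of x W] by auto
  show "x ^ n \<in> M" if "x \<in> M" for x n
    by (induction n) (use that 1 m in auto)
qed

text \<open>
  More powers of \<open>x\<close> than generators of the module are linearly dependent.
\<close>

lemma finite_algebra_imp_alg:
  assumes "finite_algebra M" "x \<in> M"
  shows "alg x"
proof -
  obtain W where W: "finite W" "M = frac_span W" using assms unfolding finite_algebra_def by blast
  have "\<forall>n. \<exists>d c. d \<in> S \<and> d \<noteq> 0 \<and> (\<forall>w\<in>W. c w \<in> S) \<and> d * x ^ n = (\<Sum>w\<in>W. c w * w)"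
    using finite_algebra_closed(7)[OF assms] W unfolding frac_span_def by blast
  then obtain d c where dc: "\<And>n. d n \<in> S" "\<And>n. d n \<noteq> 0" "\<And>n w. w \<in> W \<Longrightarrow> c n w \<in> S"
      "\<And>n. d n * x ^ n = (\<Sum>w\<in>W. c n w * w)" by metis
  have "\<exists>e. (\<forall>i\<in>{..card W}. e i \<in> S) \<and> (\<exists>i\<in>{..card W}. e i \<noteq> 0) \<and>
          (\<forall>w\<in>W. (\<Sum>i\<in>{..card W}. e i * c i w) = 0)"
    using W dc by (intro homogeneous_system_solvable[of S] one_mem diff_mem mult_mem) auto
  then obtain e where e: "\<And>i. i \<le> card W \<Longrightarrow> e i \<in> S" "\<exists>i\<le>card W. e i \<noteq> 0"
      "\<And>w. w \<in> W \<Longrightarrow> (\<Sum>i\<le>card W. e i * c i w) = 0" by blast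
  define p where "p = (\<Sum>i\<le>card W. monom (e i * d i) i)"
  have cp: "coeff p i = (if i \<le> card W then e i * d i else 0)" for i
    by (simp add: p_def coeff_sum)
  have "poly p x = (\<Sum>i\<le>card W. e i * (d i * x ^ i))"
    by (simp add: p_def poly_sum poly_monom mult_ac)
  also have "\<dots> = (\<Sum>w\<in>W. (\<Sum>i\<le>card W. e i * c i w) * w)"
    unfolding dc by (simp add: sum_distrib_left sum_distrib_right mult_ac, rule sum.swap)
  also have "\<dots> = 0" using e by simp
  finally have "poly p x = 0" .
  moreover have "p \<noteq> 0"
  proof -
    obtain i where "i \<le> card W" "e i \<noteq> 0" using e by blast
    then have "coeff p i \<noteq> 0" using dc by (simp add: cp)
    then show ?thesis by auto
  qed
  moreover have "\<forall>i. coeff p i \<in> S"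
    using dc e by (auto simp: cp intro: mult_mem zero_mem)
  ultimately show ?thesis unfolding alg_def by blast
qed

text \<open>
  The constant term of an equation for \<open>x\<close> with nonzero constant term is a multiple of \<open>x\<close>,
  so every nonzero element divides a nonzero scalar.
\<close>

lemma finite_algebra_inverse:
  assumes M: "finite_algebra M" and x: "x \<in> M" "x \<noteq> 0"
  obtains e d where "e \<in> M" "d \<in> S" "d \<noteq> 0" "e * x = d"
proof -
  have "alg x" using finite_algebra_imp_alg assms by blast
  then obtain p where p: "p \<noteq> 0" "\<forall>i. coeff p i \<in> S" "poly p x = 0" unfolding alg_def by blast
  have polyM: "poly q x \<in> M" if "\<forall>i. coeff q i \<in> S" for q
    using that
  proof (induction q)
    case (pCons a q)
    have "a \<in> S" using pCons(3)[rule_format, of 0] by simp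
    moreover have "\<forall>i. coeff q i \<in> S" using pCons(3) by (metis coeff_pCons_Suc)
    ultimately show ?case using pCons(2) finite_algebra_closed[OF M] x by auto
  qed (simp add: finite_algebra_closed[OF M])
  have "\<exists>e\<in>M. \<exists>d\<in>S. d \<noteq> 0 \<and> e * x = d" using p
  proof (induction p)
    case (pCons a p)
    have a: "a \<in> S" using pCons(4)[rule_format, of 0] by simp
    have c: "\<forall>i. coeff p i \<in> S" using pCons(4) by (metis coeff_pCons_Suc)
    show ?case
    proof (cases "a = 0")
      case True
      then show ?thesis using pCons c x by auto
    next
      case False
      have "- poly p x * x = a" using pCons(5) by (simp add: mult.commute neg_eq_iff_add_eq_0 add.commute)
      then show ?thesis using polyM[OF c] finite_algebra_closed(6)[OF M] a False by blast
    qed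
  qed auto
  then show ?thesis using that by blast
qed

text \<open>
  Adjoining to a finite algebra \<open>M\<close> a root \<open>x\<close> of a polynomial of degree \<open>m\<close> over \<open>M\<close>: the powers
  of \<open>x\<close> below the \<open>m\<close>th suffice, because the leading coefficient is invertible up to a scalar.
\<close>

lemma finite_algebra_adjoin:
  assumes M: "finite_algebra M" and p: "p \<noteq> 0" "\<And>i. coeff p i \<in> M" "poly p x = 0"
  shows "\<exists>M'. finite_algebra M' \<and> M \<subseteq> M' \<and> x \<in> M'"
proof -
  obtain W where W: "finite W" "M = frac_span W" using M unfolding finite_algebra_def by blast
  define m where "m = degree p"
  obtain e d where ed: "e \<in> M" "d \<in> S" "d \<noteq> 0" "e * coeff p m = d"
    using finite_algebra_inverse[OF M, of "coeff p m"] p by (auto simp: m_def)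
  define W' where "W' = (\<lambda>(w, i). w * x ^ i) ` (W \<times> {..<m})"
  have W': "finite W'" using W by (simp add: W'_def)
  define M' where "M' = frac_span W'"
  have red: "w * x ^ k \<in> M'" if "w \<in> M" for w k
    using that
  proof (induction k arbitrary: w rule: less_induct)
    case (less k)
    show ?case
    proof (cases "k < m")
      case True
      obtain b c where b: "b \<in> S" "b \<noteq> 0" "\<And>v. v \<in> W \<Longrightarrow> c v \<in> S" "b * w = (\<Sum>v\<in>W. c v * v)"
        using less.prems unfolding W by (elim frac_spanE) blast
      have "b * (w * x ^ k) = (\<Sum>v\<in>W. c v * (v * x ^ k))"
        using b(4) by (simp add: mult.assoc[symmetric] sum_distrib_right)
      also have "\<dots> \<in> M'"
        unfolding M'_def
        by (intro frac_span_sum frac_span_scale frac_span_base)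
           (use b W' True in \<open>auto simp: W'_def\<close>)
      finally show ?thesis using b frac_span_cancel unfolding M'_def by blast
    next
      case False
      have "(\<Sum>i\<le>m. coeff p i * x ^ i) = 0" using p by (simp add: poly_altdef m_def)
      then have lead: "coeff p m * x ^ m = - (\<Sum>i<m. coeff p i * x ^ i)"
        by (simp add: lessThan_Suc_atMost[symmetric] eq_neg_iff_add_eq_0 add.commute)
      have "d * (w * x ^ k) = e * w * x ^ (k - m) * (coeff p m * x ^ m)"
        using False by (simp add: ed(4)[symmetric] power_add[symmetric] mult_ac)
      also have "\<dots> = (\<Sum>i<m. - (e * w * coeff p i) * x ^ (k - m + i))"
        unfolding lead by (simp add: sum_distrib_left sum_negf power_add mult_ac)
      also have "\<dots> \<in> M'"
        unfolding M'_def
      proof (rule frac_span_sum)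
        fix i assume "i \<in> {..<m}"
        then have "k - m + i < k" using False by auto
        then show "- (e * w * coeff p i) * x ^ (k - m + i) \<in> frac_span W'"
          unfolding M'_def[symmetric]
          by (rule less.IH) (intro finite_algebra_closed(3,6)[OF M] ed less.prems p)
      qed
      finally show ?thesis using ed frac_span_cancel unfolding M'_def by blast
    qed
  qed
  have sub: "M \<subseteq> M'" using red[of _ 0] by auto
  have "u * v \<in> M'" if uv: "u \<in> W'" "v \<in> W'" for u v
  proof -
    obtain w i w' i' where "w \<in> W" "w' \<in> W" "u = w * x ^ i" "v = w' * x ^ i'"
      using uv unfolding W'_def by auto
    moreover have "w * w' \<in> M" using calculation(1,2) frac_span_base[OF W(1)] finite_algebra_closed(3)[OF M] unfolding W(2) by blast
    ultimately show ?thesis using red[of "w * w'" "i + i'"] by (simp add: power_add mult_ac)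
  qed
  then have "finite_algebra M'"
    unfolding finite_algebra_def
    using W' sub finite_algebra_closed(1)[OF M] frac_span_mult[of W' W' W'] by (auto simp: M'_def)
  moreover have "x \<in> M'" using red[of 1 1] finite_algebra_closed(1)[OF M] by simp
  ultimately show ?thesis using sub by blast
qed

lemma finite_algebra_base: "finite_algebra (frac_span {1})"
  unfolding finite_algebra_def
  using frac_span_base[of "{1}" 1] frac_span_mult[of "{1}" "{1}" "{1}"] by auto

lemma alg_imp_finite_algebra:
  assumes "finite A" "\<And>x. x \<in> A \<Longrightarrow> alg x"
  shows "\<exists>M. finite_algebra M \<and> A \<subseteq> M"
  using assms
proof (induction A rule: finite_induct)
  case empty
  show ?case using finite_algebra_base by blast
next
  case (insert x A)
  then obtain M where M: "finite_algebra M" "A \<subseteq> M" by auto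
  obtain p where p: "p \<noteq> 0" "\<forall>i. coeff p i \<in> S" "poly p x = 0"
    using insert.prems[of x] unfolding alg_def by blast
  have "\<exists>M'. finite_algebra M' \<and> M \<subseteq> M' \<and> x \<in> M'"
    using p(2) finite_algebra_closed(5)[OF M(1)]
    by (intro finite_algebra_adjoin[OF M(1) p(1) _ p(3)]) blast
  then show ?case using M by auto
qed

text \<open>
  The finitely many coefficients of the equation lie in one finite algebra, and adjoining the root
  keeps it finite. Sums and products of algebraic elements are covered in the same way.
\<close>

lemma alg_trans:
  assumes "p \<noteq> 0" "\<And>i. alg (coeff p i)" "poly p x = 0"
  shows "alg x"
proof -
  have "finite (range (coeff p))"
  proof (rule finite_subset)
    show "range (coeff p) \<subseteq> coeff p ` {..degree p} \<union> {0}"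
      using coeff_eq_0[of p] by (force simp: not_le[symmetric])
  qed auto
  then obtain M where M: "finite_algebra M" "range (coeff p) \<subseteq> M"
    using alg_imp_finite_algebra assms(2) by (metis (mono_tags, lifting) rangeE)
  then have "\<exists>M'. finite_algebra M' \<and> M \<subseteq> M' \<and> x \<in> M'"
    by (intro finite_algebra_adjoin[OF M(1) assms(1) _ assms(3)]) blast
  then show ?thesis using finite_algebra_imp_alg by blast
qed

lemma alg_mem: "x \<in> S \<Longrightarrow> alg x"
  using finite_algebra_imp_alg[OF finite_algebra_base] finite_algebra_closed(5)[OF finite_algebra_base]
  by blast

lemma
  assumes "alg x" "alg y"
  shows alg_add: "alg (x + y)" and alg_mult: "alg (x * y)"
proof -
  obtain M where M: "finite_algebra M" "{x, y} \<subseteq> M"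
    using alg_imp_finite_algebra[of "{x, y}"] assms by auto
  then show "alg (x + y)" "alg (x * y)"
    using finite_algebra_imp_alg[OF M(1)] finite_algebra_closed(3,4)[OF M(1)] by auto
qed

lemma alg_uminus: "alg x \<Longrightarrow> alg (- x)"
  using alg_mult[of "- 1" x] alg_mem[OF uminus_mem[OF one_mem]] by simp

lemma alg_diff: "alg x \<Longrightarrow> alg y \<Longrightarrow> alg (x - y)"
  using alg_add[of x "- y"] alg_uminus by simp

lemma alg_power: "alg x \<Longrightarrow> alg (x ^ n)"
  by (induction n) (auto intro: alg_mult alg_mem one_mem)

lemma alg_root:
  assumes "n > 0" "a \<noteq> 0" "alg a" "alg b" "a * x ^ n = b"
  shows "alg x"
proof (rule alg_trans)
  let ?p = "monom a n - [:b:]"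
  have "coeff ?p n = a" using assms(1) by (cases n) auto
  then show "?p \<noteq> 0" using assms(2) by (metis coeff_0)
  show "alg (coeff ?p i)" for i
    using assms alg_mem[OF zero_mem] by (cases i) (auto intro: alg_diff alg_uminus)
  show "poly ?p x = 0" using assms by (simp add: poly_monom)
qed

lemma alg_divide: "a \<noteq> 0 \<Longrightarrow> alg a \<Longrightarrow> alg (a * x) \<Longrightarrow> alg x"
  using alg_root[of 1 a "a * x" x] by simp

end

section \<open>Power series over complex algebras\<close>

text \<open>
  The series considered have coefficients in \<open>\<complex>\<close>, \<open>\<complex>[x]\<close> and \<open>\<complex>[x][u]\<close>, and some arguments work
  in rings of power series over these. The class supplies the complex constants in all of them.
\<close>

class complex_algebra = idom +
  fixes of_cx :: "complex \<Rightarrow> 'a"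
  assumes of_cx_1 [simp]: "of_cx 1 = 1"
    and of_cx_add: "of_cx (a + b) = of_cx a + of_cx b"
    and of_cx_mult: "of_cx (a * b) = of_cx a * of_cx b"
begin

lemma of_cx_0 [simp]: "of_cx 0 = 0"
  using of_cx_add[of 0 0] by simp

lemma of_cx_uminus: "of_cx (- a) = - of_cx a"
  using of_cx_add[of a "- a"] by (simp add: eq_neg_iff_add_eq_0 add.commute)

lemma of_cx_diff: "of_cx (a - b) = of_cx a - of_cx b"
  using of_cx_add[of a "- b"] by (simp add: of_cx_uminus)

lemma of_cx_sum: "of_cx (sum f A) = (\<Sum>i\<in>A. of_cx (f i))"
  by (induction A rule: infinite_finite_induct) (auto simp: of_cx_add)

lemma of_cx_of_nat [simp]: "of_cx (of_nat n) = of_nat n"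
  by (induction n) (auto simp: of_cx_add)

lemma of_cx_numeral [simp]: "of_cx (numeral n) = numeral n"
  using of_cx_of_nat[of "numeral n"] by simp

lemma of_cx_eq_0_iff [simp]: "of_cx a = 0 \<longleftrightarrow> a = 0"
proof
  assume "of_cx a = 0"
  then have "of_cx (a * (1 / a)) = 0" by (simp only: of_cx_mult mult_zero_left)
  then show "a = 0" by (cases "a = 0") auto
qed simp

lemma of_cx_eq_iff [simp]: "of_cx a = of_cx b \<longleftrightarrow> a = b"
  using of_cx_eq_0_iff[of "a - b"] by (simp add: of_cx_diff del: of_cx_eq_0_iff)

subclass ring_char_0
proof
  show "inj (of_nat :: nat \<Rightarrow> 'a)"
    using of_cx_eq_iff[of "of_nat _" "of_nat _"] by (intro injI) simp
qed

end

instantiation complex :: complex_algebra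
begin
definition of_cx_complex :: "complex \<Rightarrow> complex" where "of_cx_complex c = c"
instance by standard (auto simp: of_cx_complex_def)
end

instantiation poly :: (complex_algebra) complex_algebra
begin
definition of_cx_poly :: "complex \<Rightarrow> 'a poly" where "of_cx_poly c = [:of_cx c:]"
instance by standard (auto simp: of_cx_poly_def of_cx_add of_cx_mult one_pCons)
end

instantiation fps :: (complex_algebra) complex_algebra
begin
definition of_cx_fps :: "complex \<Rightarrow> 'a fps" where "of_cx_fps c = fps_const (of_cx c)"
instance by standard (auto simp: of_cx_fps_def of_cx_add of_cx_mult fps_const_add[symmetric]
  fps_const_mult[symmetric] simp del: fps_const_add fps_const_mult)
end

definition fps_lift :: "complex fps \<Rightarrow> 'a :: complex_algebra fps" where
  "fps_lift f = Abs_fps (\<lambda>n. of_cx (fps_nth f n))"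

lemma fps_lift_nth [simp]: "fps_nth (fps_lift f) n = of_cx (fps_nth f n)"
  by (simp add: fps_lift_def)

lemma fps_lift_add: "fps_lift (f + g) = fps_lift f + fps_lift g"
  by (rule fps_ext) (simp add: of_cx_add)

lemma fps_lift_mult: "fps_lift (f * g) = fps_lift f * fps_lift g"
  by (rule fps_ext) (simp add: fps_mult_nth of_cx_sum of_cx_mult)

lemma fps_lift_simps [simp]: "fps_lift 0 = 0" "fps_lift 1 = 1" "fps_lift fps_X = fps_X"
  "fps_lift (fps_const c) = fps_const (of_cx c)"
  by (rule fps_ext; simp)+

lemma fps_lift_deriv: "fps_deriv (fps_lift f) = fps_lift (fps_deriv f)"
  by (rule fps_ext) (simp add: of_cx_mult of_cx_add)

lemma fps_lift_eq_0_iff: "fps_lift f = 0 \<longleftrightarrow> f = 0"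
  by (auto simp: fps_eq_iff)

lemma fps_lift_complex: "fps_lift (f :: complex fps) = f"
  by (rule fps_ext) (simp add: of_cx_complex_def)

text \<open>
  The power of \<open>1 + q\<close> with exponent \<open>e\<close>, for \<open>q\<close> with constant term \<open>0\<close>.
\<close>

definition fps_pow :: "complex \<Rightarrow> 'a :: complex_algebra fps \<Rightarrow> 'a fps" where
  "fps_pow e q = fps_lift (fps_binomial e) oo q"

lemma fps_pow_nth_0 [simp]: "fps_nth (fps_pow e q) 0 = 1"
  by (simp add: fps_pow_def)

context
  fixes q :: "'a :: complex_algebra fps"
  assumes q0: "fps_nth q 0 = 0"
begin

lemma fps_pow_add: "fps_pow (e + e') q = fps_pow e q * fps_pow e' q"
  by (simp add: fps_pow_def fps_binomial_add_mult fps_lift_mult fps_compose_mult_distrib q0)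

lemma fps_pow_0 [simp]: "fps_pow 0 q = 1"
  by (simp add: fps_pow_def)

lemma fps_pow_1 [simp]: "fps_pow 1 q = 1 + q"
  by (simp add: fps_pow_def fps_binomial_1 fps_lift_add fps_compose_add_distrib q0)

lemma fps_pow_power: "fps_pow e q ^ n = fps_pow (of_nat n * e) q"
  by (induction n) (simp_all add: fps_pow_add ring_distribs)

lemma fps_pow_deriv:
  "(1 + q) * fps_deriv (fps_pow e q) = of_cx e * fps_deriv q * fps_pow e q"
proof -
  have "(1 + fps_X) * fps_deriv (fps_binomial e) = fps_const e * (fps_binomial e :: complex fps)"
    using fps_binomial_ODE_unique'[of "fps_binomial e" e]
    by (simp add: fps_binomial_deriv fps_divide_unit mult_ac inverse_mult_eq_1')
  then have "(1 + fps_X) * fps_deriv (fps_lift (fps_binomial e)) =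
      fps_const (of_cx e) * (fps_lift (fps_binomial e) :: 'a fps)"
    by (metis fps_lift_add fps_lift_deriv fps_lift_mult fps_lift_simps(2,3,4))
  then have "((1 + fps_X) * fps_deriv (fps_lift (fps_binomial e))) oo q =
      (fps_const (of_cx e) * (fps_lift (fps_binomial e) :: 'a fps)) oo q" by simp
  then have "(1 + q) * (fps_deriv (fps_lift (fps_binomial e)) oo q) = of_cx e * fps_pow e q"
    by (simp add: fps_compose_mult_distrib q0 fps_compose_add_distrib fps_pow_def of_cx_fps_def)
  then have "(1 + q) * (fps_deriv (fps_lift (fps_binomial e)) oo q) * fps_deriv q =
      of_cx e * fps_deriv q * fps_pow e q" by (simp add: mult_ac)
  then show ?thesis
    by (simp add: fps_pow_def fps_compose_deriv q0 mult_ac)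
qed

end

section \<open>Algebraic power series\<close>

interpretation fps_alg: subdomain "range (fps_of_poly :: 'a :: idom poly \<Rightarrow> 'a fps)"
proof
  show "1 \<in> range (fps_of_poly :: 'a poly \<Rightarrow> 'a fps)"
    using fps_of_poly_1 by (metis rangeI)
qed (auto simp: fps_of_poly_diff[symmetric] fps_of_poly_mult[symmetric])

lemma inj_fps_of_poly: "inj fps_of_poly"
  by (auto intro: injI simp: fps_of_poly_eq_iff)

lemma algebraic_fps_iff: "algebraic_fps F \<longleftrightarrow> fps_alg.alg F"
proof
  assume "algebraic_fps F"
  then obtain P where P: "P \<noteq> 0" "poly (map_poly fps_of_poly P) F = 0"
    unfolding algebraic_fps_def by blast
  have "map_poly fps_of_poly P \<noteq> 0"
    using P(1) fps_of_poly_eq_iff[of _ 0]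
    by (auto simp: poly_eq_iff coeff_map_poly)
  then show "fps_alg.alg F"
    unfolding fps_alg.alg_def using P(2)
    by (intro exI[of _ "map_poly fps_of_poly P"]) (auto simp: coeff_map_poly)
next
  assume "fps_alg.alg F"
  then obtain p where p: "p \<noteq> 0" "\<forall>i. coeff p i \<in> range fps_of_poly" "poly p F = 0"
    unfolding fps_alg.alg_def by blast
  define g where "g = inv (fps_of_poly :: 'a poly \<Rightarrow> _)"
  have "g 0 = 0" using inv_f_f[OF inj_fps_of_poly, of 0] by (simp add: g_def)
  then have eq: "map_poly fps_of_poly (map_poly g p) = p"
    using p(2) by (auto simp: poly_eq_iff coeff_map_poly g_def f_inv_into_f)
  then have "map_poly g p \<noteq> 0" using p(1) by auto
  then show "algebraic_fps F" unfolding algebraic_fps_def using p(3) eq by metis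
qed

lemmas algebraic_fps_add = fps_alg.alg_add[unfolded algebraic_fps_iff[symmetric]]
lemmas algebraic_fps_diff = fps_alg.alg_diff[unfolded algebraic_fps_iff[symmetric]]
lemmas algebraic_fps_uminus = fps_alg.alg_uminus[unfolded algebraic_fps_iff[symmetric]]
lemmas algebraic_fps_mult = fps_alg.alg_mult[unfolded algebraic_fps_iff[symmetric]]
lemmas algebraic_fps_power = fps_alg.alg_power[unfolded algebraic_fps_iff[symmetric]]
lemmas algebraic_fps_root = fps_alg.alg_root[unfolded algebraic_fps_iff[symmetric]]
lemmas algebraic_fps_divide = fps_alg.alg_divide[unfolded algebraic_fps_iff[symmetric]]
lemmas algebraic_fps_trans = fps_alg.alg_trans[unfolded algebraic_fps_iff[symmetric]]

lemma algebraic_fps_of_poly: "algebraic_fps (fps_of_poly p)"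
  unfolding algebraic_fps_iff by (rule fps_alg.alg_mem) auto

lemma algebraic_fps_const: "algebraic_fps (fps_const c)"
  using algebraic_fps_of_poly[of "[:c:]"] by (simp add: fps_of_poly_const)

lemma algebraic_fps_X: "algebraic_fps (fps_X :: 'a :: idom fps)"
  using algebraic_fps_of_poly[of "[:0, 1 :: 'a:]"] by simp

lemma algebraic_fps_0: "algebraic_fps 0" and algebraic_fps_1: "algebraic_fps 1"
  using algebraic_fps_const[of 0] algebraic_fps_const[of 1] by simp_all

lemma algebraic_fps_numeral: "algebraic_fps (numeral n)"
  using algebraic_fps_const[of "numeral n"] by (simp add: numeral_fps_const)

lemma algebraic_fps_of_cx: "algebraic_fps (of_cx c)"
  by (simp add: of_cx_fps_def algebraic_fps_const)

lemmas algebraic_fps_intros =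
  algebraic_fps_add algebraic_fps_diff algebraic_fps_uminus algebraic_fps_mult algebraic_fps_power
  algebraic_fps_const algebraic_fps_X algebraic_fps_0 algebraic_fps_1 algebraic_fps_numeral
  algebraic_fps_of_cx algebraic_fps_of_poly

lemma algebraic_fps_poly:
  "(\<And>i. algebraic_fps (coeff p i)) \<Longrightarrow> algebraic_fps x \<Longrightarrow> algebraic_fps (poly p x)"
proof (induction p)
  case (pCons a p)
  have "algebraic_fps a" using pCons(3)[of 0] by simp
  moreover have "algebraic_fps (coeff p i)" for i using pCons(3)[of "Suc i"] by simp
  ultimately show ?case using pCons by (auto intro!: algebraic_fps_intros)
qed (simp add: algebraic_fps_0)

lemma fps_deriv_poly:
  "fps_deriv (poly p F) = poly (map_poly fps_deriv p) F + poly (pderiv p) F * fps_deriv F"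
  by (induction p) (auto simp: map_poly_pCons pderiv_pCons algebra_simps)

text \<open>
  Differentiating an equation of minimal degree gives a linear equation for the derivative whose
  leading coefficient does not vanish.
\<close>

lemma algebraic_fps_deriv:
  fixes F :: "'a :: {idom, ring_char_0} fps"
  assumes "algebraic_fps F"
  shows "algebraic_fps (fps_deriv F)"
proof -
  let ?Q = "\<lambda>p. p \<noteq> 0 \<and> (\<forall>i. coeff p i \<in> range fps_of_poly) \<and> poly p F = 0"
  have "\<exists>p. ?Q p" using assms unfolding algebraic_fps_iff fps_alg.alg_def .
  then obtain p where p: "?Q p" and min: "\<And>q. ?Q q \<Longrightarrow> degree p \<le> degree q"
    using ex_has_least_nat[of ?Q _ degree] by metis
  have deg: "degree p > 0"
  proof (rule ccontr)
    assume "\<not> degree p > 0"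
    then obtain c where "p = [:c:]" using degree_eq_zeroE by blast
    then show False using p by auto
  qed
  have nat: "of_nat n * x \<in> range fps_of_poly" if "x \<in> range fps_of_poly" for n and x :: "'a fps"
    using that fps_alg.one_mem
    by (induction n) (auto simp: algebra_simps intro: fps_alg.zero_mem fps_alg.add_mem)
  have "pderiv p \<noteq> 0" using deg by (simp add: pderiv_eq_0_iff)
  moreover have c1: "coeff (pderiv p) i \<in> range fps_of_poly" for i
    using p nat unfolding coeff_pderiv by blast
  moreover have "\<not> degree p \<le> degree (pderiv p)" using deg by (simp add: degree_pderiv)
  ultimately have nz: "poly (pderiv p) F \<noteq> 0" using min[of "pderiv p"] by auto
  have "coeff (map_poly fps_deriv p) i \<in> range fps_of_poly" for i
  proof -
    obtain r where "coeff p i = fps_of_poly r" using p by blast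
    then show ?thesis by (simp add: coeff_map_poly fps_of_poly_pderiv[symmetric])
  qed
  then have "algebraic_fps (- poly (map_poly fps_deriv p) F)"
    by (intro algebraic_fps_uminus algebraic_fps_poly assms)
       (metis algebraic_fps_of_poly rangeE)
  moreover have "poly (pderiv p) F * fps_deriv F = - poly (map_poly fps_deriv p) F"
    using fps_deriv_poly[of p F] p by (simp add: eq_neg_iff_add_eq_0 add.commute)
  moreover have "algebraic_fps (poly (pderiv p) F)"
    using c1 by (intro algebraic_fps_poly assms) (metis algebraic_fps_of_poly rangeE)
  ultimately show ?thesis using nz algebraic_fps_divide by metis
qed

lemma poly_map_poly_hom:
  fixes h :: "'a :: comm_ring_1 \<Rightarrow> 'b :: comm_ring_1"
  assumes "h 0 = 0" "\<And>a b. h (a + b) = h a + h b" "\<And>a b. h (a * b) = h a * h b"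
  shows "poly (map_poly h p) (h x) = h (poly p x)"
  by (induction p) (auto simp: map_poly_pCons assms)

text \<open>
  Composition with \<open>y \<noteq> 0\<close> is an injective ring homomorphism. It turns an equation for \<open>f\<close> into one for
  \<open>f \<circ> y\<close> whose coefficients are polynomials in \<open>y\<close>, hence algebraic; transitivity finishes the proof.
\<close>

lemma algebraic_fps_compose:
  fixes y :: "'a :: complex_algebra fps"
  assumes f: "algebraic_fps f" and y: "algebraic_fps y" "fps_nth y 0 = 0"
  shows "algebraic_fps (fps_lift f oo y)"
proof (cases "y = 0")
  case True
  then show ?thesis by (simp add: algebraic_fps_const)
next
  case False
  define h :: "complex fps \<Rightarrow> 'a fps" where "h = (\<lambda>g. fps_lift g oo y)"
  have h: "h 0 = 0" "h (a + b) = h a + h b" "h (a * b) = h a * h b" for a b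
    by (simp_all add: h_def fps_lift_add fps_lift_mult fps_compose_add_distrib
        fps_compose_mult_distrib y)
  have h0: "h a = 0 \<longleftrightarrow> a = 0" for a
    using False by (auto simp: h_def fps_compose_eq_0_iff[OF y(2)] fps_lift_eq_0_iff)
  have hp: "algebraic_fps (h (fps_of_poly p))" for p
  proof (induction p)
    case (pCons a p)
    have "h (fps_of_poly (pCons a p)) = fps_const (of_cx a) + h (fps_of_poly p) * y"
      by (simp add: fps_of_poly_pCons h h_def y fps_compose_add_distrib fps_lift_add fps_lift_mult
          fps_compose_mult_distrib)
    then show ?case using pCons y by (auto intro!: algebraic_fps_intros)
  qed (simp add: h algebraic_fps_0)
  obtain P where P: "P \<noteq> 0" "poly (map_poly fps_of_poly P) f = 0"
    using f unfolding algebraic_fps_def by blast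
  have "algebraic_fps (h f)"
  proof (rule algebraic_fps_trans)
    let ?p = "map_poly h (map_poly fps_of_poly P)"
    show "?p \<noteq> 0"
      using P(1) fps_of_poly_eq_iff[of _ 0] h0 by (auto simp: poly_eq_iff coeff_map_poly)
    show "algebraic_fps (coeff ?p i)" for i
      by (simp add: coeff_map_poly h hp)
    show "poly ?p (h f) = 0"
      using P(2) by (simp add: poly_map_poly_hom h)
  qed
  then show ?thesis by (simp add: h_def)
qed

lemma algebraic_fps_pow:
  fixes q :: "'a :: complex_algebra fps"
  assumes q: "algebraic_fps q" "fps_nth q 0 = 0" and e: "e \<in> \<rat>"
  shows "algebraic_fps (fps_pow e q)"
proof -
  obtain k :: int and n :: nat where n: "n > 0" "e = of_int k / of_nat n"
  proof -
    from e obtain a b :: int where ab: "b > 0" "e = of_int a / of_int b"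
      by (cases e rule: Rats_cases') auto
    then have "e = of_int a / of_nat (nat b)" by simp
    then show thesis using that[of "nat b" a] ab by simp
  qed
  have pw: "fps_pow e q ^ n = fps_pow (of_int k) q"
    using n by (simp add: fps_pow_power q)
  have nat: "fps_pow (of_nat m) q = (1 + q) ^ m" for m
    using fps_pow_power[OF q(2), of 1 m] q by simp
  have alg: "algebraic_fps ((1 + q) ^ m)" for m
    by (intro algebraic_fps_intros q)
  show ?thesis
  proof (cases "k \<ge> 0")
    case True
    then have "fps_pow e q ^ n = (1 + q) ^ nat k" using nat[of "nat k"] by (simp add: pw)
    then show ?thesis
      using algebraic_fps_root[OF n(1) one_neq_zero algebraic_fps_1 alg] by simp
  next
    case False
    have "(1 + q) ^ nat (- k) * fps_pow e q ^ n = fps_pow (of_nat (nat (- k)) + of_int k) q"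
      unfolding pw by (simp add: nat fps_pow_add q)
    also have "of_nat (nat (- k)) + of_int k = (0 :: complex)" using False by simp
    finally have "(1 + q) ^ nat (- k) * fps_pow e q ^ n = 1" by (simp add: q)
    moreover from this have "(1 + q) ^ nat (- k) \<noteq> 0" by (metis mult_zero_left zero_neq_one)
    ultimately show ?thesis
      using algebraic_fps_root[OF n(1) _ alg algebraic_fps_1] by blast
  qed
qed

section \<open>Homogeneous Gegenbauer polynomials\<close>

text \<open>
  The polynomial \<open>t\<^sup>n C\<^sub>n(x)\<close> depends only on \<open>x t\<close> and \<open>t\<^sup>2\<close>, which are the two ring elements taken here.
  In this form the Gegenbauer polynomials can be evaluated without dividing by \<open>t\<close>. The equations are
  the three-term recurrence.
\<close>

fun geg_hom :: "complex \<Rightarrow> 'a :: complex_algebra \<Rightarrow> 'a \<Rightarrow> nat \<Rightarrow> 'a" where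
  "geg_hom l x r 0 = 1"
| "geg_hom l x r (Suc 0) = of_cx (2 * l) * x"
| "geg_hom l x r (Suc (Suc n)) = of_cx (1 / of_nat (n + 2)) *
     (of_cx (2 * (of_nat n + 1 + l)) * x * geg_hom l x r (Suc n)
      - of_cx (of_nat n + 2 * l) * r * geg_hom l x r n)"

lemma geg_hom_rec:
  "of_nat (n + 2) * geg_hom l x r (Suc (Suc n)) =
     of_cx (2 * (of_nat n + 1 + l)) * x * geg_hom l x r (Suc n)
      - of_cx (of_nat n + 2 * l) * r * geg_hom l x r n"
proof -
  have "of_nat (n + 2) * of_cx (1 / of_nat (n + 2)) = (of_cx (of_nat (n + 2) * (1 / of_nat (n + 2))) :: 'a)"
    by (simp only: of_cx_mult of_cx_of_nat)
  also have "of_nat (n + 2) * (1 / of_nat (n + 2) :: complex) = 1"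
    by (metis nonzero_mult_div_cancel_left mult.right_neutral of_nat_eq_0_iff add_is_0
        zero_neq_numeral times_divide_eq_right)
  finally have "of_nat (n + 2) * of_cx (1 / of_nat (n + 2)) = (1 :: 'a)" by simp
  then have "of_nat (n + 2) * (of_cx (1 / of_nat (n + 2)) * t) = t" for t :: 'a
    by (metis mult.assoc mult_1)
  then show ?thesis unfolding geg_hom.simps by blast
qed

lemma geg_hom_unique:
  fixes v :: "nat \<Rightarrow> 'a :: complex_algebra"
  assumes "v 0 = 1" "v (Suc 0) = of_cx (2 * l) * x"
    "\<And>n. of_nat (n + 2) * v (Suc (Suc n)) =
       of_cx (2 * (of_nat n + 1 + l)) * x * v (Suc n) - of_cx (of_nat n + 2 * l) * r * v n"
  shows "v n = geg_hom l x r n"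
proof -
  have "v n = geg_hom l x r n \<and> v (Suc n) = geg_hom l x r (Suc n)"
  proof (induction n)
    case (Suc n)
    have "of_nat (n + 2) * v (Suc (Suc n)) = of_nat (n + 2) * geg_hom l x r (Suc (Suc n))"
      unfolding assms(3) geg_hom_rec using Suc by simp
    moreover have "of_nat (n + 2) \<noteq> (0 :: 'a)" by (metis of_nat_eq_0_iff add_is_0 zero_neq_numeral)
    ultimately show ?case using Suc by (metis mult_left_cancel)
  qed (simp add: assms)
  then show ?thesis by blast
qed

lemma geg_hom_map:
  assumes h: "\<And>c. h (of_cx c) = of_cx c" "\<And>a b. h (a - b) = h a - h b" "\<And>a b. h (a * b) = h a * h b"
  shows "h (geg_hom l x r n) = geg_hom l (h x) (h r) n"
proof (induction l x r n rule: geg_hom.induct)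
  case (1 l x r)
  then show ?case using h(1)[of 1] by simp
qed (simp_all add: h)

lemma geg_hom_scale: "geg_hom l (t * x) (t ^ 2 * r) n = t ^ n * geg_hom l x r n"
  by (induction l x r n rule: geg_hom.induct) (simp_all add: algebra_simps power2_eq_square)

lemma geg_hom_square: "geg_hom l x (x ^ 2) n = of_cx (pochhammer (2 * l) n / fact n) * x ^ n"
proof (rule geg_hom_unique[symmetric])
  fix n
  have "of_nat (n + 2) * (pochhammer (2 * l) (Suc (Suc n)) / fact (Suc (Suc n))) =
     2 * (of_nat n + 1 + l) * (pochhammer (2 * l) (Suc n) / fact (Suc n))
      - (of_nat n + 2 * l) * (pochhammer (2 * l) n / fact n)"
    (is "?a = ?b")
  proof -
    have "(of_nat n + 2 :: complex) \<noteq> 0" "(of_nat n + 1 :: complex) \<noteq> 0"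
      by (metis of_nat_Suc of_nat_neq_0 add.commute of_nat_numeral of_nat_add add_2_eq_Suc')
         (metis of_nat_Suc of_nat_neq_0 add.commute)
    then show ?thesis
      by (simp add: pochhammer_Suc divide_simps) (simp add: algebra_simps)
  qed
  then have "of_cx ?a = (of_cx ?b :: 'a)" by simp
  then show "of_nat (n + 2) * (of_cx (pochhammer (2 * l) (Suc (Suc n)) / fact (Suc (Suc n))) * x ^ Suc (Suc n)) =
     of_cx (2 * (of_nat n + 1 + l)) * x * (of_cx (pochhammer (2 * l) (Suc n) / fact (Suc n)) * x ^ Suc n)
      - of_cx (of_nat n + 2 * l) * x ^ 2 * (of_cx (pochhammer (2 * l) n / fact n) * x ^ n)"
    unfolding of_cx_mult of_cx_diff of_cx_of_nat
    by (simp add: power2_eq_square left_diff_distrib[symmetric] mult.assoc[symmetric])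
       (simp add: algebra_simps)
qed auto

text \<open>
  The generating function of \<open>geg_hom l x r\<close> is this quadratic to the power \<open>-l\<close>; it is always
  handled through its first order differential equation.
\<close>

definition geg_quad :: "'a :: complex_algebra \<Rightarrow> 'a \<Rightarrow> 'a fps" where
  "geg_quad x r = 1 - 2 * fps_const x * fps_X + fps_const r * fps_X ^ 2"

lemma geg_ode_nth:
  fixes V :: "'a :: complex_algebra fps" and x r :: 'a and l :: complex
  defines "E \<equiv> geg_quad x r * fps_deriv V + of_cx l * fps_deriv (geg_quad x r) * V"
  shows "fps_nth E 0 = fps_nth V 1 - of_cx (2 * l) * x * fps_nth V 0"
    and "fps_nth E (Suc n) = of_nat (n + 2) * fps_nth V (Suc (Suc n))
      - of_cx (2 * (of_nat n + 1 + l)) * x * fps_nth V (Suc n) + of_cx (of_nat n + 2 * l) * r * fps_nth V n"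
proof -
  have E: "E = fps_deriv V - fps_const (2 * x) * (fps_X * fps_deriv V)
      + fps_const r * (fps_X * (fps_X * fps_deriv V))
      - fps_const (of_cx (2 * l) * x) * V + fps_const (of_cx (2 * l) * r) * (fps_X * V)"
    unfolding E_def geg_quad_def of_cx_fps_def
    by (simp add: fps_const_mult[symmetric] of_cx_mult numeral_fps_const power2_eq_square
        fps_deriv_power algebra_simps del: fps_const_mult)
  show "fps_nth E 0 = fps_nth V 1 - of_cx (2 * l) * x * fps_nth V 0"
    unfolding E by simp
  show "fps_nth E (Suc n) = of_nat (n + 2) * fps_nth V (Suc (Suc n))
      - of_cx (2 * (of_nat n + 1 + l)) * x * fps_nth V (Suc n) + of_cx (of_nat n + 2 * l) * r * fps_nth V n"
    unfolding E by (cases n) (simp_all add: of_cx_add of_cx_mult algebra_simps)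
qed

lemma geg_hom_ode:
  "geg_quad x r * fps_deriv (Abs_fps (geg_hom l x r)) = - of_cx l * fps_deriv (geg_quad x r) * Abs_fps (geg_hom l x r)"
proof -
  have "geg_quad x r * fps_deriv (Abs_fps (geg_hom l x r)) + of_cx l * fps_deriv (geg_quad x r) * Abs_fps (geg_hom l x r) = 0"
    (is "?E = 0")
  proof (rule fps_ext)
    show "fps_nth ?E n = fps_nth 0 n" for n
    proof (cases n)
      case 0
      show ?thesis unfolding 0 geg_ode_nth by simp
    next
      case (Suc m)
      show ?thesis
        unfolding Suc geg_ode_nth fps_nth_Abs_fps geg_hom_rec by simp
    qed
  qed
  then show ?thesis by (simp add: add_eq_0_iff)
qed

lemma geg_hom_ode_unique:
  assumes "geg_quad x r * fps_deriv V = - of_cx l * fps_deriv (geg_quad x r) * V" "fps_nth V 0 = 1"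
  shows "fps_nth V n = geg_hom l x r n"
proof (rule geg_hom_unique)
  have E: "geg_quad x r * fps_deriv V + of_cx l * fps_deriv (geg_quad x r) * V = 0"
    using assms by simp
  show "fps_nth V 0 = 1" by fact
  show "fps_nth V (Suc 0) = of_cx (2 * l) * x"
    using geg_ode_nth(1)[of x r V l] unfolding E by (simp add: assms)
  show "of_nat (n + 2) * fps_nth V (Suc (Suc n)) = of_cx (2 * (of_nat n + 1 + l)) * x * fps_nth V (Suc n)
      - of_cx (of_nat n + 2 * l) * r * fps_nth V n" for n
    using geg_ode_nth(2)[of x r V l n] unfolding E by (simp add: algebra_simps)
qed

lemma gegenbauer_eq_geg_hom: "gegenbauer l n = geg_hom l [:0, 1:] 1 n"
proof -
  let ?q = "fps_X ^ 2 - fps_const (2 * [:0, 1:]) * fps_X :: complex poly fps"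
  have q0: "fps_nth ?q 0 = 0" by simp
  have gf: "gegenbauer_gf l = fps_pow (- l) ?q"
    unfolding gegenbauer_gf_def fps_pow_def fps_lift_def by (simp add: of_cx_poly_def of_cx_complex_def)
  have Q: "geg_quad [:0, 1:] 1 = 1 + ?q"
    by (simp add: geg_quad_def fps_const_mult[symmetric] numeral_fps_const del: fps_const_mult)
  show ?thesis unfolding gegenbauer_def
    by (rule geg_hom_ode_unique)
       (simp_all add: gf Q fps_pow_deriv q0 of_cx_uminus)
qed

section \<open>Expansion in two variables\<close>

definition fps_pderiv :: "'a :: idom poly fps \<Rightarrow> 'a poly fps" where
  "fps_pderiv f = Abs_fps (\<lambda>n. pderiv (fps_nth f n))"

lemma fps_pderiv_nth [simp]: "fps_nth (fps_pderiv f) n = pderiv (fps_nth f n)"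
  by (simp add: fps_pderiv_def)

lemma pderiv_sum: "pderiv (sum f A) = (\<Sum>i\<in>A. pderiv (f i))"
  by (induction A rule: infinite_finite_induct) (simp_all add: pderiv_add)

lemma fps_pderiv_simps:
  "fps_pderiv (f + g) = fps_pderiv f + fps_pderiv g" "fps_pderiv (f - g) = fps_pderiv f - fps_pderiv g"
  "fps_pderiv (- f) = - fps_pderiv f"
  "fps_pderiv (f * g) = fps_pderiv f * g + f * fps_pderiv g"
  "fps_pderiv (fps_const p) = fps_const (pderiv p)"
  "fps_pderiv 0 = 0" "fps_pderiv 1 = 0" "fps_pderiv fps_X = 0" "fps_pderiv (numeral k) = 0"
  "fps_pderiv (fps_deriv f) = fps_deriv (fps_pderiv f)"
proof -
  show c: "fps_pderiv (fps_const p) = fps_const (pderiv p)" for p by (rule fps_ext) simp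
  show "fps_pderiv (f * g) = fps_pderiv f * g + f * fps_pderiv g"
    by (rule fps_ext, simp add: fps_mult_nth pderiv_sum sum.distrib[symmetric])
       (intro sum.cong refl, simp add: pderiv_mult mult.commute add.commute)
  show "fps_pderiv (numeral k) = 0" by (simp add: numeral_fps_const c)
  show "fps_pderiv (fps_deriv f) = fps_deriv (fps_pderiv f)"
    by (rule fps_ext) (simp add: pderiv_mult pderiv_add)
qed (rule fps_ext; simp add: pderiv_add pderiv_diff pderiv_minus)+

text \<open>
  Both derivatives of \<open>Q\<close> to the power \<open>-l\<close> are given by the chain rule. The derivative in
  the parameter inherits it from the one in the series variable: the defect \<open>V\<close> solves a
  homogeneous first order equation and starts with \<open>0\<close>.
\<close>

lemma geg_hom_param_deriv:
  fixes x r :: "'a :: complex_algebra poly" and l :: complex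
  defines "W \<equiv> Abs_fps (geg_hom l x r)" and "Q \<equiv> geg_quad x r"
  shows "Q * fps_pderiv W = - of_cx l * fps_pderiv Q * W"
proof -
  define L :: "'a poly fps" where "L = of_cx l"
  have DL: "fps_pderiv L = 0" by (simp add: L_def of_cx_fps_def of_cx_poly_def fps_pderiv_simps pderiv_pCons)
  have L': "fps_deriv L = 0" by (simp add: L_def of_cx_fps_def)
  define V where "V = Q * fps_pderiv W + L * fps_pderiv Q * W"
  have ode: "Q * fps_deriv W = - L * fps_deriv Q * W"
    unfolding L_def W_def Q_def by (rule geg_hom_ode)
  have "fps_pderiv (Q * fps_deriv W) = fps_pderiv (- L * fps_deriv Q * W)" by (simp only: ode)
  then have D: "fps_pderiv Q * fps_deriv W + Q * fps_deriv (fps_pderiv W) =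
      - L * fps_deriv (fps_pderiv Q) * W - L * fps_deriv Q * fps_pderiv W"
    by (simp add: fps_pderiv_simps DL algebra_simps)
  have V': "fps_deriv V = fps_deriv Q * fps_pderiv W + Q * fps_deriv (fps_pderiv W)
      + L * fps_deriv (fps_pderiv Q) * W + L * fps_pderiv Q * fps_deriv W"
    by (simp add: V_def L' algebra_simps)
  have "fps_deriv V = (1 - L) * (fps_deriv Q * fps_pderiv W - fps_pderiv Q * fps_deriv W)"
    using D V' by algebra
  then have "Q * fps_deriv V = (1 - L) * fps_deriv Q * V"
    using ode V_def by algebra
  then have E: "geg_quad x r * fps_deriv V + of_cx (l - 1) * fps_deriv (geg_quad x r) * V = 0"
    by (simp add: L_def of_cx_diff Q_def algebra_simps)
  have V0: "fps_nth V 0 = 0"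
    by (simp add: V_def W_def Q_def geg_quad_def numeral_fps_const)
  have "fps_nth V n = 0 \<and> fps_nth V (Suc n) = 0" for n
  proof (induction n)
    case 0
    have "fps_nth V 1 - of_cx (2 * (l - 1)) * x * fps_nth V 0 = 0"
      unfolding geg_ode_nth(1)[of x r V "l - 1", symmetric] E by simp
    then show ?case using V0 by simp
  next
    case (Suc n)
    have "of_nat (n + 2) * fps_nth V (Suc (Suc n)) = 0"
      using geg_ode_nth(2)[of x r V "l - 1" n] Suc unfolding E by simp
    moreover have "of_nat (n + 2) \<noteq> (0 :: 'a poly)" by (metis of_nat_eq_0_iff add_is_0 zero_neq_numeral)
    ultimately show ?case using Suc by (metis mult_eq_0_iff)
  qed
  then have "V = 0" by (intro fps_ext) simp
  then show ?thesis by (simp add: V_def L_def add_eq_0_iff)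
qed

text \<open>
  What remains of the partial differential equation below once every derivative of \<open>W = Q\<close> to the
  power \<open>-l\<close> is written as a rational function times \<open>W\<close> and denominators are cleared.
\<close>

lemma geg_pde_identity:
  fixes X Y Z L :: "'a :: idom"
  assumes "H * 2 = 1" and "C = L + H"
    and "Q = 1 - 2 * (Y + Z - 2 * Y * Z) * X + (Z - Y) ^ 2 * X ^ 2"
    and "Q' = - 2 * (Y + Z - 2 * Y * Z) + 2 * (Z - Y) ^ 2 * X"
    and "Q'' = 2 * (Z - Y) ^ 2"
    and "DQ = - 2 * (1 - 2 * Z) * X - 2 * (Z - Y) * X ^ 2"
    and "DDQ = 2 * X ^ 2"
  shows "Y * (1 - Y) * (L * (1 + L) * DQ ^ 2 - L * DDQ * Q) - (C - (2 * L + 1) * Y) * L * DQ * Q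
     = X * (X * (- L * Q' * Q) + X ^ 2 * (L * (1 + L) * Q' ^ 2 - L * Q'' * Q)
             + (2 * L + C) * (X * (- L * Q' * Q)) + 2 * L * C * Q ^ 2)
       - (X * (- L * Q' * Q) + X ^ 2 * (L * (1 + L) * Q' ^ 2 - L * Q'' * Q) + 2 * L * (X * (- L * Q' * Q)))"
  using assms by algebra

text \<open>
  With \<open>x = y + z - 2 y z\<close> and \<open>r = (z - y)\<^sup>2\<close>, the hypergeometric operator in \<open>y\<close> without its constant
  term acts on the generating function like \<open>X (\<theta> + 2 l) (\<theta> + l + 1/2) - \<theta> (\<theta> + 2 l)\<close>, where \<open>X\<close> is the
  series variable and \<open>\<theta> = X d/dX\<close>. This is the reason for Brafman's choice of \<open>y\<close> and \<open>z\<close>.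
\<close>

lemma geg_hom_pde:
  fixes z :: "'a :: complex_algebra" and l :: complex
  defines "x \<equiv> [:z, 1 - 2 * z:]" and "r \<equiv> [:z, - 1:] ^ 2"
  defines "W \<equiv> Abs_fps (geg_hom l x r)"
  defines "Y \<equiv> fps_const [:0, 1:]" and "t1 \<equiv> fps_X * fps_deriv W"
  defines "t2 \<equiv> fps_X * fps_deriv t1"
  shows "Y * fps_pderiv (fps_pderiv W) - Y * (Y * fps_pderiv (fps_pderiv W)) + of_cx (l + 1 / 2) * fps_pderiv W
       - of_cx (2 * l + 1) * (Y * fps_pderiv W) =
     fps_X * (t2 + of_cx (3 * l + 1 / 2) * t1 + of_cx (2 * l * (l + 1 / 2)) * W)
       - (t2 + of_cx (2 * l) * t1)"
proof -
  define L :: "'a poly fps" where "L = of_cx l"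
  define H :: "'a poly fps" where "H = of_cx (1 / 2)"
  define C where "C = L + H"
  define Z where "Z = fps_const [:z:]"
  define X :: "'a poly fps" where "X = fps_X"
  define Q where "Q = geg_quad x r"
  have H2: "H * 2 = 1"
    unfolding H_def using of_cx_mult[of "1/2" 2, where 'a = "'a poly fps"] by simp
  have cs: "of_cx (l + 1 / 2) = C" "of_cx (2 * l + 1) = 2 * L + 1" "of_cx (3 * l + 1 / 2) = 2 * L + C"
     "of_cx (2 * l * (l + 1 / 2)) = 2 * L * C" "of_cx (2 * l) = 2 * L"
    by (simp_all add: of_cx_add of_cx_mult C_def L_def H_def)
  have DL: "fps_pderiv L = 0" by (simp add: L_def of_cx_fps_def of_cx_poly_def fps_pderiv_simps pderiv_pCons)
  have L': "fps_deriv L = 0" by (simp add: L_def of_cx_fps_def)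
  have DYZ: "fps_pderiv Y = 1" "fps_pderiv Z = 0" "fps_deriv Y = 0" "fps_deriv Z = 0"
       "fps_pderiv X = 0" "fps_deriv X = 1"
    by (simp_all add: Y_def Z_def X_def fps_pderiv_simps pderiv_pCons one_pCons[symmetric] fps_const_1_eq_1)
  have xr: "fps_const x = Y + Z - 2 * Y * Z" "fps_const r = (Z - Y) ^ 2"
  proof -
    have "x = [:0,1:] + [:z:] - 2 * [:0,1:] * [:z:]" by (simp add: x_def numeral_poly)
    then show "fps_const x = Y + Z - 2 * Y * Z"
      by (simp add: Y_def Z_def numeral_fps_const)
    have "r = ([:z:] - [:0,1:]) ^ 2" by (simp add: r_def)
    then show "fps_const r = (Z - Y) ^ 2" by (simp add: Y_def Z_def fps_const_power)
  qed
  have Q: "Q = 1 - 2 * (Y + Z - 2 * Y * Z) * X + (Z - Y) ^ 2 * X ^ 2"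
    by (simp add: Q_def geg_quad_def xr X_def)
  have Q': "fps_deriv Q = - 2 * (Y + Z - 2 * Y * Z) + 2 * (Z - Y) ^ 2 * X"
    unfolding Q by (simp add: DYZ power2_eq_square algebra_simps)
  have Q'': "fps_deriv (fps_deriv Q) = 2 * (Z - Y) ^ 2"
    unfolding Q' by (simp add: DYZ power2_eq_square algebra_simps)
  have DQ: "fps_pderiv Q = - 2 * (1 - 2 * Z) * X - 2 * (Z - Y) * X ^ 2"
    unfolding Q by (simp add: DYZ fps_pderiv_simps power2_eq_square algebra_simps)
  have DDQ: "fps_pderiv (fps_pderiv Q) = 2 * X ^ 2"
    unfolding DQ by (simp add: DYZ fps_pderiv_simps power2_eq_square algebra_simps)
  have ode: "Q * fps_deriv W = - L * fps_deriv Q * W"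
    unfolding L_def W_def Q_def by (rule geg_hom_ode)
  have par: "Q * fps_pderiv W = - L * fps_pderiv Q * W"
    unfolding L_def W_def Q_def by (rule geg_hom_param_deriv)
  have "fps_deriv (Q * fps_deriv W) = fps_deriv (- L * fps_deriv Q * W)" by (simp only: ode)
  then have "fps_deriv Q * fps_deriv W + Q * fps_deriv (fps_deriv W) =
      - L * (fps_deriv (fps_deriv Q) * W + fps_deriv Q * fps_deriv W)"
    by (simp add: L' algebra_simps)
  then have ode2: "Q ^ 2 * fps_deriv (fps_deriv W) =
      (L * (1 + L) * fps_deriv Q ^ 2 - L * fps_deriv (fps_deriv Q) * Q) * W"
    using ode by algebra
  have "fps_pderiv (Q * fps_pderiv W) = fps_pderiv (- L * fps_pderiv Q * W)" by (simp only: par)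
  then have "fps_pderiv Q * fps_pderiv W + Q * fps_pderiv (fps_pderiv W) =
      - L * (fps_pderiv (fps_pderiv Q) * W + fps_pderiv Q * fps_pderiv W)"
    by (simp add: DL fps_pderiv_simps algebra_simps)
  then have par2: "Q ^ 2 * fps_pderiv (fps_pderiv W) =
      (L * (1 + L) * fps_pderiv Q ^ 2 - L * fps_pderiv (fps_pderiv Q) * Q) * W"
    using par by algebra
  have t2: "t2 = X * fps_deriv W + X ^ 2 * fps_deriv (fps_deriv W)"
    by (simp add: t2_def t1_def X_def algebra_simps power2_eq_square)
  have t1: "t1 = X * fps_deriv W" by (simp add: t1_def X_def)
  note id = geg_pde_identity[OF H2 C_def Q Q' Q'' DQ DDQ]
  let ?lhs = "Y * fps_pderiv (fps_pderiv W) - Y * (Y * fps_pderiv (fps_pderiv W)) + C * fps_pderiv W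
       - (2 * L + 1) * (Y * fps_pderiv W)"
  let ?rhs = "X * (t2 + (2 * L + C) * t1 + 2 * L * C * W) - (t2 + 2 * L * t1)"
  define q1 where "q1 = fps_deriv Q"
  define q2 where "q2 = fps_deriv (fps_deriv Q)"
  define d1 where "d1 = fps_pderiv Q"
  define d2 where "d2 = fps_pderiv (fps_pderiv Q)"
  have l: "Q ^ 2 * ?lhs = (Y * (1 - Y) * (L * (1 + L) * d1 ^ 2 - L * d2 * Q) - (C - (2 * L + 1) * Y) * L * d1 * Q) * W"
    using par2 par unfolding d2_def[symmetric] unfolding d1_def[symmetric] by algebra
  have r: "Q ^ 2 * ?rhs = (X * (X * (- L * q1 * Q) + X ^ 2 * (L * (1 + L) * q1 ^ 2 - L * q2 * Q)
             + (2 * L + C) * (X * (- L * q1 * Q)) + 2 * L * C * Q ^ 2)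
       - (X * (- L * q1 * Q) + X ^ 2 * (L * (1 + L) * q1 ^ 2 - L * q2 * Q) + 2 * L * (X * (- L * q1 * Q)))) * W"
    using ode2 ode unfolding t1 t2 q2_def[symmetric] unfolding q1_def[symmetric] by algebra
  have "Q ^ 2 * ?lhs = Q ^ 2 * ?rhs"
    unfolding l r using id unfolding q2_def[symmetric] d2_def[symmetric]
    unfolding q1_def[symmetric] d1_def[symmetric] by simp
  moreover have "fps_nth (Q ^ 2) 0 = 1"
    by (simp add: Q_def geg_quad_def numeral_fps_const power2_eq_square)
  then have "Q ^ 2 \<noteq> 0" by (metis fps_zero_nth zero_neq_one)
  ultimately have "?lhs = ?rhs" by (metis mult_left_cancel)
  then show ?thesis by (simp only: cs X_def)
qed

text \<open>
  The coefficient of \<open>y\<^sup>i X\<^sup>n\<close> in the preceding equation.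
\<close>

lemma geg_hom_coeff_rec:
  fixes z :: "'a :: complex_algebra" and l :: complex
  defines "P \<equiv> geg_hom l [:z, 1 - 2 * z:] ([:z, - 1:] ^ 2)"
  shows "of_cx ((of_nat i + 1) * (of_nat i + l + 1 / 2)) * coeff (P n) (Suc i) =
    (if n = 0 then 0 else of_cx ((of_nat n - 1 + 2 * l) * (of_nat n - 1 / 2 + l)) * coeff (P (n - 1)) i)
    + of_cx ((of_nat i - of_nat n) * (of_nat i + of_nat n + 2 * l)) * coeff (P n) i"
proof -
  have sm: "of_cx c * p = smult (of_cx c) p" for c and p :: "'a poly"
    by (simp add: of_cx_poly_def)
  note pde = geg_hom_pde[where z = z and l = l, THEN arg_cong[where f = "\<lambda>F. coeff (fps_nth F n) i"], folded P_def]
  have "coeff (pCons 0 (pderiv (pderiv (P n)))) i - coeff (pCons 0 (pCons 0 (pderiv (pderiv (P n))))) i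
      + of_cx (l + 1 / 2) * coeff (pderiv (P n)) i - of_cx (2 * l + 1) * coeff (pCons 0 (pderiv (P n))) i
    = (if n = 0 then 0 else of_nat (n - 1) * (of_nat (n - 1) * coeff (P (n - 1)) i)
         + of_cx (3 * l + 1 / 2) * (of_nat (n - 1) * coeff (P (n - 1)) i) + of_cx (2 * l * (l + 1 / 2)) * coeff (P (n - 1)) i)
      - (of_nat n * (of_nat n * coeff (P n) i) + of_cx (2 * l) * (of_nat n * coeff (P n) i))"
    (is "?a = ?b")
  proof -
    have nat: "coeff (of_nat k * p) i = of_nat k * coeff p i" for k and p :: "'a poly"
      by (simp add: of_nat_poly)
    have th: "fps_nth (fps_X * fps_deriv F) k = of_nat k * fps_nth F k" for k and F :: "'a poly fps"
      by (cases k) simp_all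
    have "?a = coeff (fps_nth (fps_const [:0, 1:] * fps_pderiv (fps_pderiv (Abs_fps P))
       - fps_const [:0, 1:] * (fps_const [:0, 1:] * fps_pderiv (fps_pderiv (Abs_fps P)))
       + of_cx (l + 1 / 2) * fps_pderiv (Abs_fps P)
       - of_cx (2 * l + 1) * (fps_const [:0, 1:] * fps_pderiv (Abs_fps P))) n) i"
      by (simp add: of_cx_fps_def sm coeff_pCons split: nat.split)
    also have "\<dots> = ?b"
    proof -
      define t1 where "t1 = fps_X * fps_deriv (Abs_fps P)"
      define t2 where "t2 = fps_X * fps_deriv t1"
      have t: "fps_nth t1 k = of_nat k * P k" "fps_nth t2 k = of_nat k * (of_nat k * P k)" for k
        unfolding t2_def th unfolding t1_def th by simp_all
      show ?thesis
        unfolding pde[folded t1_def, folded t2_def]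
        by (cases n) (simp_all add: of_cx_fps_def sm t nat del: of_nat_Suc)
    qed
    finally show ?thesis .
  qed
  moreover have "?a = of_cx ((of_nat i + 1) * (of_nat i + l + 1 / 2)) * coeff (P n) (Suc i)
      - of_cx (of_nat i * (of_nat i + 2 * l)) * coeff (P n) i"
  proof -
    have c1: "of_cx ((of_nat i + 1) * (of_nat i + l + 1 / 2)) =
        (of_nat i * of_nat (Suc i) + of_cx (l + 1 / 2) * of_nat (Suc i) :: 'a)"
    proof -
      have "(of_nat i + 1) * (of_nat i + l + 1 / 2) = of_nat i * of_nat (Suc i) + (l + 1 / 2) * of_nat (Suc i)"
        by (simp add: algebra_simps)
      then show ?thesis by (simp only: of_cx_add of_cx_mult of_cx_of_nat)
    qed
    have c2: "of_cx (of_nat i * (of_nat i + 2 * l)) =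
        (of_nat i * of_nat (i - 1) + of_cx (2 * l + 1) * of_nat i :: 'a)"
    proof -
      have "of_nat i * (of_nat i + 2 * l) = of_nat i * of_nat (i - 1) + (2 * l + 1) * of_nat i"
        by (cases i) (simp_all add: algebra_simps)
      then show ?thesis by (simp only: of_cx_add of_cx_mult of_cx_of_nat)
    qed
    consider "i = 0" | "i = Suc 0" | k where "i = Suc (Suc k)"
      by (metis not0_implies_Suc)
    then show ?thesis
      unfolding c1 c2 by cases (simp_all add: coeff_pderiv algebra_simps)
  qed
  moreover have "?b = (if n = 0 then 0 else of_cx ((of_nat n - 1 + 2 * l) * (of_nat n - 1 / 2 + l)) * coeff (P (n - 1)) i)
      - of_cx (of_nat n * (of_nat n + 2 * l)) * coeff (P n) i"
  proof (cases n)
    case (Suc k)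
    have "of_cx ((of_nat n - 1 + 2 * l) * (of_nat n - 1 / 2 + l)) =
        (of_nat k * of_nat k + of_cx (3 * l + 1 / 2) * of_nat k + of_cx (2 * l * (l + 1 / 2)) :: 'a)"
    proof -
      have "(of_nat n - 1 + 2 * l) * (of_nat n - 1 / 2 + l) =
          of_nat k * of_nat k + (3 * l + 1 / 2) * of_nat k + 2 * l * (l + 1 / 2)"
        by (simp add: Suc algebra_simps)
      then show ?thesis by (simp only: of_cx_add of_cx_mult of_cx_of_nat)
    qed
    then show ?thesis by (simp add: Suc of_cx_mult of_cx_add algebra_simps)
  qed (simp add: of_cx_mult of_cx_add)
  moreover have k: "of_cx ((of_nat i - of_nat n) * (of_nat i + of_nat n + 2 * l)) =
      (of_cx (of_nat i * (of_nat i + 2 * l)) - of_cx (of_nat n * (of_nat n + 2 * l)) :: 'a)"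
    unfolding of_cx_diff[symmetric] by (simp add: algebra_simps)
  ultimately have "of_cx ((of_nat i + 1) * (of_nat i + l + 1 / 2)) * coeff (P n) (Suc i)
      - of_cx (of_nat i * (of_nat i + 2 * l)) * coeff (P n) i =
      (if n = 0 then 0 else of_cx ((of_nat n - 1 + 2 * l) * (of_nat n - 1 / 2 + l)) * coeff (P (n - 1)) i)
      - of_cx (of_nat n * (of_nat n + 2 * l)) * coeff (P n) i"
    by (simp only:)
  then show ?thesis unfolding k by algebra
qed

text \<open>
  \<open>geg_coeff l i n j\<close> is the coefficient of \<open>y\<^sup>i z\<^sup>j\<close> in the \<open>n\<close>th homogeneous Gegenbauer polynomial at
  \<open>y + z - 2 y z\<close> and \<open>(z - y)\<^sup>2\<close>. The recursion on \<open>i\<close> is the one just found; it starts at \<open>y = 0\<close>,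
  where the generating function is \<open>1 - z X\<close> to the power \<open>-2 l\<close>.
\<close>

primrec geg_coeff :: "complex \<Rightarrow> nat \<Rightarrow> nat \<Rightarrow> nat \<Rightarrow> complex" where
  "geg_coeff l 0 = (\<lambda>n j. if n = j then pochhammer (2 * l) n / fact n else 0)"
| "geg_coeff l (Suc i) = (\<lambda>n j.
     ((if n = 0 then 0 else (of_nat n - 1 + 2 * l) * (of_nat n - 1 / 2 + l) * geg_coeff l i (n - 1) j)
      + (of_nat i - of_nat n) * (of_nat i + of_nat n + 2 * l) * geg_coeff l i n j)
     / ((of_nat i + 1) * (of_nat i + l + 1 / 2)))"

text \<open>
  The polynomial has order at least \<open>n\<close> in \<open>y, z\<close> jointly and degree at most \<open>n\<close> in each of them.
\<close>

lemma geg_coeff_eq_0: "n < j \<or> i + j < n \<or> n < i \<Longrightarrow> geg_coeff l i n j = 0"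
proof (induction i arbitrary: n)
  case (Suc i)
  have "n = 0 \<or> geg_coeff l i (n - 1) j = 0"
    using Suc.prems by (cases "n = 0") (auto intro!: Suc.IH)
  moreover have "n = i \<or> geg_coeff l i n j = 0"
    using Suc.prems by (cases "n = i") (auto intro!: Suc.IH)
  ultimately show ?case by auto
qed auto

lemma of_nat_plus_1_neq_0: "of_nat n + 1 \<noteq> (0 :: complex)"
  using of_nat_neq_0[of n, where 'a = complex] by (simp add: add.commute)

lemma coeff_geg_hom:
  fixes z :: "'a :: complex_algebra"
  assumes l: "\<And>k. of_nat k + l + 1 / 2 \<noteq> 0" and "n \<le> N"
  shows "coeff (geg_hom l [:z, 1 - 2 * z:] ([:z, - 1:] ^ 2) n) i = (\<Sum>j\<le>N. of_cx (geg_coeff l i n j) * z ^ j)"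
  using assms(2)
proof (induction i arbitrary: n)
  case 0
  have "coeff (geg_hom l [:z, 1 - 2 * z:] ([:z, - 1:] ^ 2) n) 0 =
      poly (geg_hom l [:z, 1 - 2 * z:] ([:z, - 1:] ^ 2) n) 0"
    by (simp add: poly_0_coeff_0)
  also have "\<dots> = geg_hom l z (z ^ 2) n"
    by (subst geg_hom_map[of "\<lambda>p. poly p 0"]) (simp_all add: of_cx_poly_def)
  also have "\<dots> = of_cx (geg_coeff l 0 n n) * z ^ n"
    by (simp add: geg_hom_square)
  also have "\<dots> = (\<Sum>j\<le>N. of_cx (geg_coeff l 0 n j) * z ^ j)"
    using 0 by (subst sum.remove[of _ n]) auto
  finally show ?case .
next
  case (Suc i)
  let ?P = "geg_hom l [:z, 1 - 2 * z:] ([:z, - 1:] ^ 2)"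
  let ?d = "(of_nat i + 1) * (of_nat i + l + 1 / 2) :: complex"
  let ?e = "(of_nat n - 1 + 2 * l) * (of_nat n - 1 / 2 + l)"
  let ?f = "(of_nat i - of_nat n) * (of_nat i + of_nat n + 2 * l)"
  have d: "?d \<noteq> 0" using l[of i] of_nat_plus_1_neq_0[of i] by simp
  then have gc: "?d * geg_coeff l (Suc i) n j =
      (if n = 0 then 0 else ?e * geg_coeff l i (n - 1) j) + ?f * geg_coeff l i n j" for j
    by (simp del: mult_eq_0_iff)
  have g: "of_cx ?d * of_cx (geg_coeff l (Suc i) n j) = (if n = 0 then 0 else
      of_cx ?e * of_cx (geg_coeff l i (n - 1) j)) + (of_cx ?f * of_cx (geg_coeff l i n j) :: 'a)" for j
  proof -
    have lin: "of_cx (a * x + b * y) = of_cx a * of_cx x + (of_cx b * of_cx y :: 'a)" for a b x y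
      by (simp add: of_cx_add of_cx_mult)
    show ?thesis
      unfolding of_cx_mult[of ?d, symmetric] gc
      using lin[of 0 0 ?f] lin[of ?e "geg_coeff l i (n - 1) j" ?f]
      by (cases "n = 0") simp_all
  qed
  have "of_cx ?d * coeff (?P n) (Suc i) = (\<Sum>j\<le>N. (if n = 0 then 0 else
      of_cx ?e * of_cx (geg_coeff l i (n - 1) j)) * z ^ j + of_cx ?f * of_cx (geg_coeff l i n j) * z ^ j)"
    unfolding geg_hom_coeff_rec using Suc
    by (simp add: sum_distrib_left sum.distrib mult.assoc)
  also have "\<dots> = of_cx ?d * (\<Sum>j\<le>N. of_cx (geg_coeff l (Suc i) n j) * z ^ j)"
    unfolding sum_distrib_left mult.assoc[symmetric] g by (simp add: distrib_right)
  finally show ?case using d mult_left_cancel[of "of_cx ?d :: 'a"] by (simp del: mult_eq_0_iff)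
qed

lemma geg_hom_expansion:
  fixes y z :: "'a :: complex_algebra"
  assumes l: "\<And>k. of_nat k + l + 1 / 2 \<noteq> 0" and n: "n \<le> N"
  shows "geg_hom l (y + z - 2 * y * z) ((z - y) ^ 2) n =
    (\<Sum>i\<le>N. \<Sum>j\<le>N. of_cx (geg_coeff l i n j) * y ^ i * z ^ j)"
proof -
  let ?p = "geg_hom l [:z, 1 - 2 * z:] ([:z, - 1:] ^ 2) n"
  have "coeff ?p i = 0" if "i > N" for i
    using that n by (subst coeff_geg_hom[OF l n]) (auto intro!: sum.neutral simp: geg_coeff_eq_0)
  then have deg: "degree ?p \<le> N" by (intro degree_le) auto
  have "geg_hom l (y + z - 2 * y * z) ((z - y) ^ 2) n = poly ?p y"
    by (subst geg_hom_map[of "\<lambda>p. poly p y"]) (simp_all add: of_cx_poly_def algebra_simps)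
  also have "\<dots> = (\<Sum>i\<le>N. coeff ?p i * y ^ i)"
    unfolding poly_altdef using deg by (intro sum.mono_neutral_left) (auto simp: coeff_eq_0)
  also have "\<dots> = (\<Sum>i\<le>N. \<Sum>j\<le>N. of_cx (geg_coeff l i n j) * y ^ i * z ^ j)"
    unfolding coeff_geg_hom[OF l n] sum_distrib_right by (simp add: mult_ac)
  finally show ?thesis .
qed

section \<open>Brafman's factorization\<close>

definition hyp2F1 :: "complex \<Rightarrow> complex \<Rightarrow> complex \<Rightarrow> complex fps" where
  "hyp2F1 a b c = Abs_fps (\<lambda>n. pochhammer a n * pochhammer b n / (pochhammer c n * fact n))"

lemma hyp2F1_nth: "fps_nth (hyp2F1 a b c) n = pochhammer a n * pochhammer b n / (pochhammer c n * fact n)"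
  by (simp add: hyp2F1_def)

definition brafman_coeff :: "complex \<Rightarrow> complex \<Rightarrow> nat \<Rightarrow> complex" where
  "brafman_coeff l g n = pochhammer g n * pochhammer (2 * l - g) n /
     (pochhammer (2 * l) n * pochhammer (l + 1 / 2) n)"

text \<open>
  Write \<open>a\<^sub>n\<close> for \<open>brafman_coeff l g n\<close>. Since
  \<open>a\<^sub>n\<^sub>+\<^sub>1 (n + 2 l) (n + l + 1/2) = a\<^sub>n (n + g) (n + 2 l - g)\<close>, summing the recursion of \<open>geg_coeff\<close> against \<open>a\<^sub>n\<close>
  collects the factor \<open>(n + g) (n + 2 l - g) + (i - n) (i + n + 2 l) = (i + g) (i + 2 l - g)\<close>. It is
  independent of \<open>n\<close>, so both sides satisfy the same recursion in \<open>i\<close>.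
\<close>

lemma brafman_coeff_sum:
  assumes l: "\<And>k. of_nat k + l + 1 / 2 \<noteq> 0" "\<And>k. of_nat k + 2 * l \<noteq> 0" and N: "i + j \<le> N"
  shows "(\<Sum>n\<le>N. brafman_coeff l g n * geg_coeff l i n j) =
    fps_nth (hyp2F1 g (2 * l - g) (l + 1 / 2)) i * fps_nth (hyp2F1 g (2 * l - g) (l + 1 / 2)) j"
  using N
proof (induction i arbitrary: N)
  case 0
  have "pochhammer (2 * l) j \<noteq> 0"
    using l(2) by (auto simp: pochhammer_eq_0_iff add_eq_0_iff)
  moreover have "(\<Sum>n\<le>N. brafman_coeff l g n * geg_coeff l 0 n j) = brafman_coeff l g j * geg_coeff l 0 j j"
    using 0 by (subst sum.remove[of _ j]) auto
  ultimately show ?case by (simp add: hyp2F1_nth brafman_coeff_def)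
next
  case (Suc i)
  let ?F = "fps_nth (hyp2F1 g (2 * l - g) (l + 1 / 2))"
  let ?a = "brafman_coeff l g" and ?b = "geg_coeff l i"
  let ?d = "(of_nat i + 1) * (of_nat i + l + 1 / 2) :: complex"
  obtain M where M: "N = Suc M" "i + j \<le> M" using Suc.prems by (cases N) auto
  have d: "?d \<noteq> 0" using l(1)[of i] of_nat_plus_1_neq_0[of i] by simp
  have p: "pochhammer (2 * l) n \<noteq> 0" "pochhammer (l + 1 / 2) n \<noteq> 0" for n
    using l by (auto simp: pochhammer_eq_0_iff add_eq_0_iff add.assoc)
  have a_Suc: "?a (Suc n) * ((of_nat n + 2 * l) * (of_nat n + 1 / 2 + l)) = ?a n * ((of_nat n + g) * (of_nat n + 2 * l - g))" for n
  proof -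
    have "?a (Suc n) = ?a n * ((of_nat n + g) * (of_nat n + 2 * l - g)) / ((of_nat n + 2 * l) * (of_nat n + 1 / 2 + l))"
    proof -
      have e: "g + of_nat n = of_nat n + g" "2 * l - g + of_nat n = of_nat n + 2 * l - g"
        "2 * l + of_nat n = of_nat n + 2 * l" "l + 1 / 2 + of_nat n = of_nat n + 1 / 2 + l"
        by (simp_all add: algebra_simps)
      show ?thesis
        unfolding brafman_coeff_def pochhammer_Suc e by (simp add: mult_ac)
    qed
    moreover have "(of_nat n + 2 * l) * (of_nat n + 1 / 2 + l) \<noteq> 0"
      using l(1)[of n] l(2)[of n] by (simp add: add_ac)
    ultimately show ?thesis by (simp del: mult_eq_0_iff)
  qed
  have gc: "?d * geg_coeff l (Suc i) n j = (if n = 0 then 0 else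
      (of_nat n - 1 + 2 * l) * (of_nat n - 1 / 2 + l) * ?b (n - 1) j)
      + (of_nat i - of_nat n) * (of_nat i + of_nat n + 2 * l) * ?b n j" for n
    using d by (simp del: mult_eq_0_iff)
  have F_Suc: "(of_nat i + g) * (of_nat i + 2 * l - g) * ?F i = ?d * ?F (Suc i)"
    using l(1)[of i] p(2)[of i] of_nat_plus_1_neq_0[of i]
    by (simp add: hyp2F1_nth pochhammer_Suc divide_simps add.commute) (simp add: algebra_simps)
  have "?d * (\<Sum>n\<le>N. ?a n * geg_coeff l (Suc i) n j) =
      (\<Sum>n\<le>N. ?a n * (if n = 0 then 0 else (of_nat n - 1 + 2 * l) * (of_nat n - 1 / 2 + l) * ?b (n - 1) j))
      + (\<Sum>n\<le>N. ?a n * ((of_nat i - of_nat n) * (of_nat i + of_nat n + 2 * l) * ?b n j))"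
    unfolding sum_distrib_left sum.distrib[symmetric]
    unfolding mult.left_commute[of ?d] gc by (simp only: distrib_left)
  also have "(\<Sum>n\<le>N. ?a n * (if n = 0 then 0 else (of_nat n - 1 + 2 * l) * (of_nat n - 1 / 2 + l) * ?b (n - 1) j))
      = (\<Sum>n\<le>M. ?a (Suc n) * ((of_nat n + 2 * l) * (of_nat n + 1 / 2 + l)) * ?b n j)"
    unfolding M sum.atMost_Suc_shift by (simp add: algebra_simps)
  also have "\<dots> = (\<Sum>n\<le>M. ?a n * ((of_nat n + g) * (of_nat n + 2 * l - g)) * ?b n j)"
    unfolding a_Suc ..
  also have "(\<Sum>n\<le>N. ?a n * ((of_nat i - of_nat n) * (of_nat i + of_nat n + 2 * l) * ?b n j)) =
      (\<Sum>n\<le>M. ?a n * ((of_nat i - of_nat n) * (of_nat i + of_nat n + 2 * l) * ?b n j))"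
    using M by (simp add: geg_coeff_eq_0)
  also have "(\<Sum>n\<le>M. ?a n * ((of_nat n + g) * (of_nat n + 2 * l - g)) * ?b n j) + \<dots> =
      (of_nat i + g) * (of_nat i + 2 * l - g) * (\<Sum>n\<le>M. ?a n * ?b n j)"
    unfolding sum_distrib_left sum.distrib[symmetric]
    by (intro sum.cong refl) (simp add: algebra_simps)
  also have "\<dots> = (of_nat i + g) * (of_nat i + 2 * l - g) * (?F i * ?F j)"
    using Suc.IH[OF M(2)] by simp
  also have "\<dots> = ?d * (?F (Suc i) * ?F j)"
    unfolding mult.assoc[symmetric] F_Suc ..
  finally show ?case using d mult_left_cancel[of ?d] by blast
qed

lemma fps_compose_nth_truncate:
  assumes "fps_nth y 0 = 0" "m \<le> N"
  shows "fps_nth (fps_lift f oo y) m = fps_nth (\<Sum>i\<le>N. of_cx (fps_nth f i) * y ^ i) m"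
proof -
  have "fps_nth (fps_lift f oo y) m = (\<Sum>i\<le>m. of_cx (fps_nth f i) * fps_nth (y ^ i) m)"
    by (simp add: fps_compose_nth atMost_atLeast0)
  also have "\<dots> = (\<Sum>i\<le>N. of_cx (fps_nth f i) * fps_nth (y ^ i) m)"
    using assms by (intro sum.mono_neutral_left) (auto simp: startsby_zero_power_prefix)
  finally show ?thesis by (simp add: fps_sum_nth of_cx_fps_def)
qed

text \<open>
  Comparing coefficients of \<open>y\<^sup>i z\<^sup>j\<close> reduces the factorization to
  \<open>brafman_coeff_sum\<close>. The terms of
  the sum are of order at least \<open>n\<close>, so a coefficient of the series needs finitely many of them.
\<close>

theorem brafman:
  fixes y z :: "'a :: complex_algebra fps" and l g :: complex
  assumes l: "\<And>k. of_nat k + l + 1 / 2 \<noteq> 0" "\<And>k. of_nat k + 2 * l \<noteq> 0"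
    and yz: "fps_nth y 0 = 0" "fps_nth z 0 = 0" and m: "m \<le> N"
  defines "F \<equiv> hyp2F1 g (2 * l - g) (l + 1 / 2)"
  shows "fps_nth (\<Sum>n\<le>N. of_cx (brafman_coeff l g n) * geg_hom l (y + z - 2 * y * z) ((z - y) ^ 2) n) m =
    fps_nth ((fps_lift F oo y) * (fps_lift F oo z)) m"
proof -
  have nth: "fps_nth (of_cx c * G) m = of_cx c * fps_nth G m" for c and G :: "'a fps"
    by (simp add: of_cx_fps_def)
  have small: "fps_nth (y ^ i * z ^ j) m = 0" if "m < i + j" for i j
  proof -
    have "fps_nth (y ^ i) k * fps_nth (z ^ j) (m - k) = 0" if "k \<le> m" for k
      using that \<open>m < i + j\<close> yz by (cases "k < i") (auto simp: startsby_zero_power_prefix)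
    then show ?thesis unfolding fps_mult_nth by (intro sum.neutral) auto
  qed
  have "(\<Sum>n\<le>N. of_cx (brafman_coeff l g n) * geg_hom l (y + z - 2 * y * z) ((z - y) ^ 2) n) =
      (\<Sum>n\<le>N. \<Sum>i\<le>N. \<Sum>j\<le>N. of_cx (brafman_coeff l g n * geg_coeff l i n j) * (y ^ i * z ^ j))"
    by (intro sum.cong refl, subst geg_hom_expansion[OF l(1), of _ N])
       (simp_all add: sum_distrib_left of_cx_mult mult.assoc)
  also have "\<dots> = (\<Sum>i\<le>N. \<Sum>j\<le>N. \<Sum>n\<le>N. of_cx (brafman_coeff l g n * geg_coeff l i n j) * (y ^ i * z ^ j))"
    by (rule trans[OF sum.swap], rule sum.cong[OF refl], rule sum.swap)
  also have "\<dots> = (\<Sum>i\<le>N. \<Sum>j\<le>N. of_cx (\<Sum>n\<le>N. brafman_coeff l g n * geg_coeff l i n j) * (y ^ i * z ^ j))"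
    by (simp add: of_cx_sum sum_distrib_right)
  finally have "fps_nth (\<Sum>n\<le>N. of_cx (brafman_coeff l g n) * geg_hom l (y + z - 2 * y * z) ((z - y) ^ 2) n) m =
      (\<Sum>i\<le>N. \<Sum>j\<le>N. of_cx (\<Sum>n\<le>N. brafman_coeff l g n * geg_coeff l i n j) * fps_nth (y ^ i * z ^ j) m)"
    by (simp add: fps_sum_nth nth)
  also have "\<dots> = (\<Sum>i\<le>N. \<Sum>j\<le>N. of_cx (fps_nth F i * fps_nth F j) * fps_nth (y ^ i * z ^ j) m)"
  proof (intro sum.cong refl)
    fix i j
    show "of_cx (\<Sum>n\<le>N. brafman_coeff l g n * geg_coeff l i n j) * fps_nth (y ^ i * z ^ j) m =
        of_cx (fps_nth F i * fps_nth F j) * fps_nth (y ^ i * z ^ j) m"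
    proof (cases "i + j \<le> N")
      case True
      then show ?thesis unfolding F_def by (simp add: brafman_coeff_sum[OF l])
    next
      case False
      then show ?thesis using m by (simp add: small)
    qed
  qed
  also have "\<dots> = fps_nth ((\<Sum>i\<le>N. of_cx (fps_nth F i) * y ^ i) * (\<Sum>j\<le>N. of_cx (fps_nth F j) * z ^ j)) m"
  proof -
    have "(\<Sum>i\<le>N. of_cx (fps_nth F i) * y ^ i) * (\<Sum>j\<le>N. of_cx (fps_nth F j) * z ^ j) =
       (\<Sum>i\<le>N. \<Sum>j\<le>N. of_cx (fps_nth F i * fps_nth F j) * (y ^ i * z ^ j))"
      unfolding sum_product by (intro sum.cong refl) (simp add: of_cx_mult mult_ac)
    then show ?thesis by (simp add: fps_sum_nth nth)
  qed
  also have "\<dots> = fps_nth ((fps_lift F oo y) * (fps_lift F oo z)) m"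
    unfolding fps_mult_nth using m
    by (intro sum.cong refl arg_cong2[where f = "(*)"] fps_compose_nth_truncate[symmetric] yz) auto
  finally show ?thesis .
qed

section \<open>From the hypergeometric function to the generating functions\<close>

text \<open>
  The arguments \<open>y, z\<close> of the factorization are \<open>(1 - S \<mp> s) / 2\<close> with
  \<open>S\<^sup>2 = 1 - 2 x + s\<^sup>2\<close>; this solves \<open>y + z - 2 y z = x\<close> and \<open>z - y = s\<close>.
\<close>

lemma brafman_algebraic:
  fixes x s :: "'a :: complex_algebra fps" and l g :: complex
  assumes l: "\<And>k. of_nat k + l + 1 / 2 \<noteq> 0" "\<And>k. of_nat k + 2 * l \<noteq> 0"
    and xs: "fps_nth x 0 = 0" "fps_nth s 0 = 0" "algebraic_fps x" "algebraic_fps s"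
    and F: "algebraic_fps (hyp2F1 g (2 * l - g) (l + 1 / 2))"
  shows "\<exists>B. algebraic_fps B \<and> (\<forall>N. \<forall>m\<le>N.
    fps_nth (\<Sum>n\<le>N. of_cx (brafman_coeff l g n) * geg_hom l x (s ^ 2) n) m = fps_nth B m)"
proof -
  let ?F = "hyp2F1 g (2 * l - g) (l + 1 / 2)"
  define q where "q = s ^ 2 - 2 * x"
  have q: "fps_nth q 0 = 0" "algebraic_fps q"
    using xs by (auto simp: q_def power2_eq_square numeral_fps_const intro!: algebraic_fps_intros)
  define S where "S = fps_pow (1 / 2) q"
  have S: "algebraic_fps S" "fps_nth S 0 = 1"
    by (auto simp: S_def intro!: algebraic_fps_pow q)
  have S2: "S ^ 2 = 1 + s ^ 2 - 2 * x"
    unfolding S_def fps_pow_power[OF q(1)] using q(1) by (simp add: q_def)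
  define h :: "'a fps" where "h = of_cx (1 / 2)"
  have h: "h * 2 = 1" "algebraic_fps h"
    using of_cx_mult[of "1 / 2" 2, where 'a = "'a fps"] by (simp_all add: h_def algebraic_fps_of_cx)
  define y where "y = h * (1 - S - s)"
  define z where "z = h * (1 - S + s)"
  have yz: "fps_nth y 0 = 0" "fps_nth z 0 = 0" "algebraic_fps y" "algebraic_fps z"
    using S xs h by (auto simp: y_def z_def intro!: algebraic_fps_intros)
  have x: "y + z - 2 * y * z = x" and s: "z - y = s"
    using h(1) S2 unfolding y_def z_def by algebra+
  show ?thesis
  proof (intro exI conjI allI impI)
    show "algebraic_fps ((fps_lift ?F oo y) * (fps_lift ?F oo z))"
      by (intro algebraic_fps_mult algebraic_fps_compose F yz)
    show "fps_nth (\<Sum>n\<le>N. of_cx (brafman_coeff l g n) * geg_hom l x (s ^ 2) n) m =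
        fps_nth ((fps_lift ?F oo y) * (fps_lift ?F oo z)) m" if "m \<le> N" for m N
      using brafman[OF l yz(1,2) that, of g] by (simp only: x s)
  qed
qed

lemma geg_hom_const: "geg_hom l (fps_const x) 1 n = fps_const (geg_hom l x 1 n)"
  using geg_hom_map[of fps_const l x 1 n] by (simp add: of_cx_fps_def)

lemma algebraic_gegenbauer_series1:
  assumes l: "\<And>k. of_nat k + l + 1 / 2 \<noteq> 0" "\<And>k. of_nat k + 2 * l \<noteq> 0"
    and F: "algebraic_fps (hyp2F1 g (2 * l - g) (l + 1 / 2))"
  shows "algebraic_fps (gegenbauer_series1 l g)"
proof -
  define x :: "complex poly fps" where "x = fps_X * fps_const [:0, 1:]"
  obtain B where B: "algebraic_fps B" "\<And>N m. m \<le> N \<Longrightarrow>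
      fps_nth (\<Sum>n\<le>N. of_cx (brafman_coeff l g n) * geg_hom l x (fps_X ^ 2) n) m = fps_nth B m"
    using brafman_algebraic[OF l _ _ _ _ F, of x fps_X]
    by (auto simp: x_def intro!: algebraic_fps_intros)
  have g: "geg_hom l x (fps_X ^ 2) n = fps_X ^ n * fps_const (gegenbauer l n)" for n
    using geg_hom_scale[of l fps_X "fps_const [:0, 1:]" 1 n]
    by (simp add: x_def geg_hom_const gegenbauer_eq_geg_hom)
  have "fps_nth B N = fps_nth (gegenbauer_series1 l g) N" for N
  proof -
    have "fps_nth B N = (\<Sum>n\<le>N. of_cx (brafman_coeff l g n) * (if n = N then gegenbauer l n else 0))"
      unfolding B(2)[OF order_refl, symmetric] g
      by (simp add: fps_sum_nth of_cx_fps_def fps_X_power_mult_nth) (intro sum.cong refl, auto)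
    also have "\<dots> = of_cx (brafman_coeff l g N) * gegenbauer l N"
      by (subst sum.remove[of _ N]) auto
    also have "\<dots> = fps_nth (gegenbauer_series1 l g) N"
      by (simp add: gegenbauer_series1_def brafman_coeff_def of_cx_poly_def of_cx_complex_def)
    finally show ?thesis .
  qed
  then have "B = gegenbauer_series1 l g" by (rule fps_ext)
  then show ?thesis using B by simp
qed

text \<open>
  The \<open>k\<close>th Taylor coefficient at \<open>w = 0\<close> of the Gegenbauer generating function taken at
  \<open>t (1 + w)\<close>. Since \<open>1 - 2 x t (1 + w) + t\<^sup>2 (1 + w)\<^sup>2 = R\<^sup>2 - 2 w t (x - t) + w\<^sup>2 t\<^sup>2\<close> with
  \<open>R\<^sup>2 = 1 - 2 x t + t\<^sup>2\<close>, it is again a Gegenbauer polynomial.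
\<close>

lemma gegenbauer_binomial_rec:
  fixes x :: "'a :: complex_algebra" and l :: complex
  defines "M \<equiv> \<lambda>k. Abs_fps (\<lambda>n. of_nat (n choose k) * geg_hom l x 1 n)"
  defines "c \<equiv> fps_const x"
  shows "of_nat (Suc k) * ((1 - 2 * c * fps_X + fps_X ^ 2) * M (Suc k)) =
    of_cx (2 * (of_nat k + l)) * (fps_X * (c - fps_X)) * M k
    - (if k = 0 then 0 else of_cx (of_nat (k - 1) + 2 * l) * fps_X ^ 2 * M (k - 1))"
    (is "?L = ?R")
proof (rule fps_ext)
  fix n
  define b :: "nat \<Rightarrow> nat \<Rightarrow> 'a" where "b = (\<lambda>m k. of_nat (m choose k))"
  define bm :: "nat \<Rightarrow> 'a" where "bm = (\<lambda>m. if k = 0 then 0 else b m (k - 1))"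
  define L :: 'a where "L = of_cx l"
  define G where "G = geg_hom l x 1"
  have absorb: "of_nat (Suc k) * b (Suc m) (Suc k) = of_nat (Suc m) * b m k" for m k
    unfolding b_def of_nat_mult[symmetric] Suc_times_binomial ..
  have pascal: "b (Suc m) (Suc k) = b m k + b m (Suc k)" for m k
    by (simp add: b_def)
  have absorb': "of_nat (Suc k) * b m (Suc k) = (of_nat m - of_nat k) * b m k" for m k
    using absorb[of k m] pascal[of m k] by (simp add: algebra_simps)
  have bm: "b (Suc m) k = b m k + bm m" "of_nat k * b m k = (of_nat m - of_nat k + 1) * bm m" for m
    using pascal[of m "k - 1"] absorb'[of "k - 1" m]
    by (cases k; simp add: bm_def b_def algebra_simps)+
  have L: "?L = of_nat (Suc k) * (M (Suc k) - 2 * c * (fps_X * M (Suc k)) + fps_X * (fps_X * M (Suc k)))"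
    by (simp add: algebra_simps power2_eq_square)
  have R: "?R = of_cx (2 * (of_nat k + l)) * (c * (fps_X * M k) - fps_X * (fps_X * M k))
    - (if k = 0 then 0 else of_cx (of_nat (k - 1) + 2 * l) * (fps_X * (fps_X * M (k - 1))))"
    by (simp add: algebra_simps power2_eq_square)
  have cst: "fps_nth (of_nat m * F) j = of_nat m * fps_nth F j" "fps_nth (of_cx e * F) j = of_cx e * fps_nth F j"
     "fps_nth (2 * c * F) j = 2 * x * fps_nth F j" "fps_nth (c * F) j = x * fps_nth F j"
    for m j e and F :: "'a fps"
    by (simp_all add: fps_of_nat[symmetric] of_cx_fps_def c_def numeral_fps_const)
  have Mn: "fps_nth (M k) j = b j k * G j" for k j by (simp add: M_def b_def G_def)
  have of: "of_cx (2 * (of_nat k + l)) = 2 * (of_nat k + L)" by (simp add: L_def of_cx_mult of_cx_add)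
  consider "n = 0" | "n = Suc 0" | m where "n = Suc (Suc m)" by (metis not0_implies_Suc)
  then show "fps_nth ?L n = fps_nth ?R n"
  proof cases
    case 1
    then show ?thesis unfolding L R by (simp add: cst Mn b_def)
  next
    case 2
    then show ?thesis unfolding L R
      by (cases k) (simp_all add: cst Mn b_def G_def of_cx_fps_def c_def)
  next
    case (3 m)
    have rec: "(of_nat m + 2) * G (Suc (Suc m)) = 2 * (of_nat m + 1 + L) * x * G (Suc m) - (of_nat m + 2 * L) * G m"
      using geg_hom_rec[of m l x 1] by (simp add: G_def L_def of_cx_add of_cx_mult algebra_simps)
    have "fps_nth ?L n = of_nat (Suc k) * (b (Suc (Suc m)) (Suc k) * G (Suc (Suc m))
       - 2 * x * (b (Suc m) (Suc k) * G (Suc m)) + b m (Suc k) * G m)"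
      unfolding L 3 by (simp add: cst Mn del: of_nat_Suc)
    also have "\<dots> = (of_nat m + 2) * b (Suc m) k * G (Suc (Suc m))
       - 2 * x * ((of_nat m + 1 - of_nat k) * b (Suc m) k * G (Suc m)) + (of_nat m - of_nat k) * b m k * G m"
      using absorb[of k "Suc m"] absorb'[of k "Suc m"] absorb'[of k m] unfolding of_nat_Suc by algebra
    also have "\<dots> = 2 * (of_nat k + L) * (x * (b (Suc m) k * G (Suc m)) - b m k * G m)
       - (of_nat k - 1 + 2 * L) * (bm m * G m)"
      using rec bm[of m] by algebra
    also have "\<dots> = fps_nth ?R n"
    proof (cases k)
      case 0
      then show ?thesis unfolding R 3 using of by (simp add: cst Mn bm_def)
    next
      case (Suc k')
      then show ?thesis unfolding R 3
        by (simp add: cst Mn of bm_def) (simp add: L_def of_cx_add of_cx_mult)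
    qed
    finally show ?thesis .
  qed
qed

lemma gegenbauer_binomial_series:
  fixes x :: "'a :: complex_algebra" and l :: complex
  defines "q \<equiv> fps_X ^ 2 - 2 * fps_const x * fps_X"
  shows "Abs_fps (\<lambda>n. of_nat (n choose k) * geg_hom l x 1 n) = fps_pow (- l) q *
    geg_hom l (fps_pow (- 1) q * (fps_X * (fps_const x - fps_X))) (fps_pow (- 1) q * fps_X ^ 2) k"
proof -
  define M where "M = (\<lambda>k. Abs_fps (\<lambda>n. of_nat (n choose k) * geg_hom l x 1 n))"
  define R where "R = 1 - 2 * fps_const x * fps_X + fps_X ^ 2"
  define I where "I = fps_pow (- 1) q"
  have q0: "fps_nth q 0 = 0" by (simp add: q_def numeral_fps_const)
  have Rq: "R = 1 + q" by (simp add: R_def q_def)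
  have RI: "I * R = 1"
    using fps_pow_add[OF q0, of "-1" 1] by (simp add: I_def Rq q0)
  have Q: "geg_quad x 1 = 1 + q" by (simp add: geg_quad_def q_def)
  have E: "fps_nth (fps_pow (- l) q) n = geg_hom l x 1 n" for n
    by (rule geg_hom_ode_unique) (simp_all add: Q fps_pow_deriv q0 of_cx_uminus)
  let ?x = "I * (fps_X * (fps_const x - fps_X))" and ?r = "I * fps_X ^ 2"
  have rec: "of_nat (Suc k) * M (Suc k) = of_cx (2 * (of_nat k + l)) * ?x * M k
      - (if k = 0 then 0 else of_cx (of_nat (k - 1) + 2 * l) * ?r * M (k - 1))" for k
  proof -
    have "of_nat (Suc k) * M (Suc k) = I * (of_nat (Suc k) * (R * M (Suc k)))"
      using RI by algebra
    also have "\<dots> = I * (of_cx (2 * (of_nat k + l)) * (fps_X * (fps_const x - fps_X)) * M k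
        - (if k = 0 then 0 else of_cx (of_nat (k - 1) + 2 * l) * fps_X ^ 2 * M (k - 1)))"
      unfolding R_def M_def gegenbauer_binomial_rec ..
    finally show ?thesis
      by (cases "k = 0") (simp_all add: right_diff_distrib[of I] mult_ac del: of_nat_Suc)
  qed
  have M0: "M 0 = fps_pow (- l) q" by (rule fps_ext) (simp add: M_def E)
  have "M k = fps_pow (- l) q * geg_hom l ?x ?r k \<and> M (Suc k) = fps_pow (- l) q * geg_hom l ?x ?r (Suc k)"
  proof (induction k)
    case 0
    then show ?case using rec[of 0] by (simp add: M0 mult_ac)
  next
    case (Suc k)
    have "of_nat (k + 2) * M (Suc (Suc k)) = of_cx (2 * (of_nat k + 1 + l)) * ?x * M (Suc k)
        - of_cx (of_nat k + 2 * l) * ?r * M k"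
      using rec[of "Suc k"] by (simp add: add_ac)
    also have "\<dots> = fps_pow (- l) q * (of_nat (k + 2) * geg_hom l ?x ?r (Suc (Suc k)))"
      unfolding geg_hom_rec using Suc by (simp add: algebra_simps)
    finally have "of_nat (k + 2) * M (Suc (Suc k)) =
        of_nat (k + 2) * (fps_pow (- l) q * geg_hom l ?x ?r (Suc (Suc k)))"
      by (simp only: mult.left_commute)
    moreover have "of_nat (k + 2) \<noteq> (0 :: 'a fps)" by (metis of_nat_eq_0_iff add_is_0 zero_neq_numeral)
    ultimately show ?case using Suc mult_left_cancel by blast
  qed
  then show ?thesis by (simp add: M_def I_def)
qed

text \<open>
  The upper parameter \<open>-N\<close> contributes \<open>(-N)\<^sub>k / k! = (-1)\<^sup>k (N choose k)\<close>.
\<close>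

lemma gegenbauer_series2_nth:
  "fps_nth (gegenbauer_series2 l g) N = (\<Sum>k\<le>N. of_cx (brafman_coeff l g k) * (- [:0, 1:]) ^ k *
     (of_nat (N choose k) * [:gegenbauer l N:]))"
proof (rule poly_eqI)
  fix i
  have t: "of_cx (brafman_coeff l g k) * (- [:0, 1:]) ^ k * (of_nat (N choose k) * [:gegenbauer l N:])
      = monom (smult (brafman_coeff l g k * (-1) ^ k * of_nat (N choose k)) (gegenbauer l N)) k"
    for k
  proof -
    have "- [:0, 1 :: complex poly:] = monom (- 1) 1"
      by (simp add: monom_Suc monom_0)
    then have "(- [:0, 1 :: complex poly:]) ^ k = monom ((- 1) ^ k) k"
      by (simp only: monom_power mult_1)
    moreover have "((- 1) ^ k :: complex poly) = [:(- 1) ^ k:]"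
      by (cases "even k") (simp_all, simp add: one_pCons)
    ultimately show ?thesis
      by (simp add: of_cx_poly_def of_cx_complex_def of_nat_poly mult_monom smult_monom mult_ac)
  qed
  have p: "pochhammer (- of_nat N) i / fact i = (-1) ^ i * (of_nat (N choose i) :: complex)"
    unfolding binomial_gbinomial gbinomial_pochhammer by (simp add: power_mult_distrib[symmetric])
  have "coeff (fps_nth (gegenbauer_series2 l g) N) i =
      (if i \<le> N then smult (pochhammer (- of_nat N) i / fact i * brafman_coeff l g i) (gegenbauer l N) else 0)"
    by (simp add: gegenbauer_series2_def hyp_3F2_poly_def coeff_map_poly coeff_truncate_fps
        brafman_coeff_def mult_ac)
  also have "\<dots> = (\<Sum>k\<le>N. if k = i then smult (brafman_coeff l g k * (-1) ^ k * of_nat (N choose k)) (gegenbauer l N) else 0)"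
    unfolding p by (simp add: mult_ac)
  finally show "coeff (fps_nth (gegenbauer_series2 l g) N) i = coeff (\<Sum>k\<le>N. of_cx (brafman_coeff l g k) * (- [:0, 1:]) ^ k *
     (of_nat (N choose k) * [:gegenbauer l N:])) i"
    unfolding t by (simp add: coeff_sum)
qed

text \<open>
  After the interchange of the summations over \<open>n\<close> and \<open>k\<close> the inner sum is the series of the lemma
  \<open>gegenbauer_binomial_series\<close>. So the second series is \<open>R\<close> to the power \<open>-2 l\<close> times the first one
  with \<open>(x, t)\<close> replaced by \<open>((x - t) / R, - u t / R)\<close>; rationality of \<open>l\<close> makes the power algebraic.
\<close>

lemma algebraic_gegenbauer_series2:
  assumes l: "\<And>k. of_nat k + l + 1 / 2 \<noteq> 0" "\<And>k. of_nat k + 2 * l \<noteq> 0" "l \<in> \<rat>"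
    and F: "algebraic_fps (hyp2F1 g (2 * l - g) (l + 1 / 2))"
  shows "algebraic_fps (gegenbauer_series2 l g)"
proof -
  define x :: "complex poly poly" where "x = [:[:0, 1:]:]"
  define u :: "complex poly poly fps" where "u = fps_const [:0, 1:]"
  define q where "q = fps_X ^ 2 - 2 * fps_const x * fps_X"
  have q: "fps_nth q 0 = 0" "algebraic_fps q"
    by (auto simp: q_def numeral_fps_const intro!: algebraic_fps_intros)
  define E where "E = fps_pow (- l) q"
  define I where "I = fps_pow (- 1) q"
  define J where "J = fps_pow (- 1 / 2) q"
  have "- l \<in> \<rat>" using l(3) by simp
  then have alg: "algebraic_fps E" "algebraic_fps I" "algebraic_fps J"
    by (auto simp: E_def I_def J_def intro!: algebraic_fps_pow q)
  have JI: "J ^ 2 = I" unfolding I_def J_def fps_pow_power[OF q(1)] by simp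
  let ?x = "I * (fps_X * (fps_const x - fps_X))" and ?r = "I * fps_X ^ 2"
  define s where "s = - u * J * fps_X"
  have s: "fps_nth s 0 = 0" "algebraic_fps s"
    by (auto simp: s_def u_def intro!: algebraic_fps_intros alg)
  have x0: "fps_nth (- u * ?x) 0 = 0" "algebraic_fps (- u * ?x)"
    by (auto simp: u_def intro!: algebraic_fps_intros alg)
  have s2: "(- u) ^ 2 * ?r = s ^ 2"
    by (simp add: s_def JI[symmetric] power2_eq_square algebra_simps)
  obtain B where B: "algebraic_fps B" "\<And>N m. m \<le> N \<Longrightarrow>
      fps_nth (\<Sum>n\<le>N. of_cx (brafman_coeff l g n) * geg_hom l (- u * ?x) (s ^ 2) n) m = fps_nth B m"
    using brafman_algebraic[OF l(1,2) x0(1) s(1) x0(2) s(2) F] by blast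
  define M where "M = (\<lambda>k. Abs_fps (\<lambda>n. of_nat (n choose k) * geg_hom l x 1 n))"
  have M: "(- u) ^ k * M k = E * geg_hom l (- u * ?x) (s ^ 2) k" for k
    unfolding s2[symmetric] geg_hom_scale M_def gegenbauer_binomial_series
    by (simp add: E_def I_def q_def mult_ac)
  have gx: "[:gegenbauer l n:] = geg_hom l x 1 n" for n
    using geg_hom_map[of "\<lambda>p. [:p:]" l "[:0, 1:]" 1 n]
    by (simp add: gegenbauer_eq_geg_hom of_cx_poly_def x_def one_pCons[symmetric] mult.commute)
  have u: "fps_nth ((- u) ^ k * G) n = (- [:0, 1:]) ^ k * fps_nth G n" for k n G
  proof -
    have "(- u) ^ k = fps_const ((- [:0, 1:]) ^ k)" by (simp add: u_def fps_const_power)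
    then show ?thesis by simp
  qed
  have "fps_nth (gegenbauer_series2 l g) N = fps_nth (E * B) N" for N
  proof -
    have "fps_nth (gegenbauer_series2 l g) N =
        fps_nth (\<Sum>k\<le>N. of_cx (brafman_coeff l g k) * ((- u) ^ k * M k)) N"
      unfolding gegenbauer_series2_nth
      by (simp add: fps_sum_nth of_cx_fps_def u M_def gx mult.assoc del: mult_minus_left)
    also have "(\<Sum>k\<le>N. of_cx (brafman_coeff l g k) * ((- u) ^ k * M k)) =
        E * (\<Sum>n\<le>N. of_cx (brafman_coeff l g n) * geg_hom l (- u * ?x) (s ^ 2) n)"
      unfolding M by (simp add: sum_distrib_left mult_ac)
    also have "fps_nth \<dots> N = fps_nth (E * B) N"
      unfolding fps_mult_nth by (intro sum.cong refl arg_cong2[where f = "(*)"] B(2)) auto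
    finally show ?thesis .
  qed
  then have "gegenbauer_series2 l g = E * B" by (rule fps_ext)
  then show ?thesis using alg B algebraic_fps_mult by simp
qed

section \<open>Contiguous hypergeometric functions\<close>

lemma hyp2F1_commute: "hyp2F1 a b c = hyp2F1 b a c"
  by (simp add: hyp2F1_def mult_ac)

lemma hyp2F1_nth_Suc:
  "fps_nth (hyp2F1 a b c) (Suc n) = fps_nth (hyp2F1 a b c) n *
     ((a + of_nat n) * (b + of_nat n) / ((c + of_nat n) * of_nat (Suc n)))"
  unfolding hyp2F1_nth pochhammer_Suc fact_Suc of_nat_mult by (simp add: mult_ac del: of_nat_Suc)

lemma fps_X_deriv_nth: "fps_nth (fps_X * fps_deriv F) n = of_nat n * fps_nth F n"
  by (cases n) simp_all

lemma pochhammer_nonzero: "(\<And>n. c + of_nat n \<noteq> 0) \<Longrightarrow> pochhammer c n \<noteq> (0 :: complex)"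
  by (induction n) (simp_all add: pochhammer_Suc)

text \<open>
  The next four identities express the contiguous functions in terms of a hypergeometric function and
  its derivative. They can be solved for the function on the left if the scalar factor there does not
  vanish.
\<close>

lemma hyp2F1_raise:
  "fps_const a * hyp2F1 (a + 1) b c = fps_X * fps_deriv (hyp2F1 a b c) + fps_const a * hyp2F1 a b c"
proof (rule fps_ext)
  fix n
  have "a * pochhammer (a + 1) n = (of_nat n + a) * pochhammer a n"
    using pochhammer_rec[of a n] pochhammer_Suc[of a n] by (simp add: mult_ac add_ac)
  then have "a * fps_nth (hyp2F1 (a + 1) b c) n = (of_nat n + a) * pochhammer a n * pochhammer b n / (pochhammer c n * fact n)"
    by (simp add: hyp2F1_nth mult.assoc[symmetric])
  also have "\<dots> = of_nat n * fps_nth (hyp2F1 a b c) n + a * fps_nth (hyp2F1 a b c) n"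
    by (simp add: hyp2F1_nth distrib_right add_divide_distrib mult.assoc)
  finally show "fps_nth (fps_const a * hyp2F1 (a + 1) b c) n =
      fps_nth (fps_X * fps_deriv (hyp2F1 a b c) + fps_const a * hyp2F1 a b c) n"
    unfolding fps_add_nth fps_X_deriv_nth fps_mult_left_const_nth .
qed

lemma hyp2F1_lower:
  assumes "\<And>n. c + of_nat n \<noteq> 0"
  shows "fps_const (c - a - 1) * hyp2F1 a b c =
     fps_X * (1 - fps_X) * fps_deriv (hyp2F1 (a + 1) b c)
     + fps_const (c - a - 1) * hyp2F1 (a + 1) b c - fps_const b * fps_X * hyp2F1 (a + 1) b c" (is "?L = ?R")
proof (rule fps_ext)
  fix m
  have R: "?R = fps_X * fps_deriv (hyp2F1 (a + 1) b c) - fps_X * (fps_X * fps_deriv (hyp2F1 (a + 1) b c))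
     + fps_const (c - a - 1) * hyp2F1 (a + 1) b c - fps_const b * (fps_X * hyp2F1 (a + 1) b c)"
    by (simp add: algebra_simps)
  show "fps_nth ?L m = fps_nth ?R m"
  proof (cases m)
    case 0
    then show ?thesis by (simp add: hyp2F1_nth)
  next
    case (Suc n)
    define f where "f = fps_nth (hyp2F1 (a + 1) b c) n"
    define N where "N = (of_nat n :: complex)"
    have nz: "(c + N) * (N + 1) \<noteq> 0"
      using assms[of n] of_nat_plus_1_neq_0[of n] by (simp add: N_def)
    have f1: "fps_nth (hyp2F1 (a + 1) b c) (Suc n) = f * ((a + 1 + N) * (b + N) / ((c + N) * (N + 1)))"
      unfolding hyp2F1_nth_Suc f_def N_def by (simp add: add_ac)
    have F: "fps_nth (hyp2F1 a b c) (Suc n) = f * (a * (b + N) / ((c + N) * (N + 1)))"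
      unfolding f_def hyp2F1_nth pochhammer_rec[of a] pochhammer_Suc[of b] pochhammer_Suc[of c] fact_Suc N_def
      by (simp add: mult_ac add_ac)
    have fX: "fps_nth (fps_X * (fps_X * fps_deriv G)) (Suc n) = N * fps_nth G n" for G
      by (cases n) (simp_all add: N_def)
    have "fps_nth ?R (Suc n) = (N + 1) * fps_nth (hyp2F1 (a + 1) b c) (Suc n) - N * f
        + (c - a - 1) * fps_nth (hyp2F1 (a + 1) b c) (Suc n) - b * f"
      unfolding R fps_sub_nth fps_add_nth fX by (simp add: f_def N_def add_ac)
    also have "\<dots> = (c - a - 1) * fps_nth (hyp2F1 a b c) (Suc n)"
      unfolding f1 F using nz by (simp add: divide_simps) algebra
    finally show ?thesis unfolding Suc by simp
  qed
qed

lemma hyp2F1_lower_denominator: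
  assumes "\<And>n. c + of_nat n \<noteq> 0"
  shows "fps_const c * hyp2F1 a b c = fps_X * fps_deriv (hyp2F1 a b (c + 1)) + fps_const c * hyp2F1 a b (c + 1)"
proof (rule fps_ext)
  fix n
  have p: "pochhammer c n \<noteq> 0" "pochhammer (c + 1) n \<noteq> 0"
  proof -
    show "pochhammer c n \<noteq> 0" by (rule pochhammer_nonzero[OF assms])
    have "c + 1 + of_nat m \<noteq> 0" for m using assms[of "Suc m"] by (simp add: add_ac)
    then show "pochhammer (c + 1) n \<noteq> 0" by (rule pochhammer_nonzero)
  qed
  have "c * pochhammer (c + 1) n = (of_nat n + c) * pochhammer c n"
    using pochhammer_rec[of c n] pochhammer_Suc[of c n] by (simp add: mult_ac add_ac)
  then have "c / pochhammer c n = (of_nat n + c) / pochhammer (c + 1) n"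
    using p by (simp add: frac_eq_eq)
  then have "c * fps_nth (hyp2F1 a b c) n = (of_nat n + c) * fps_nth (hyp2F1 a b (c + 1)) n"
    unfolding hyp2F1_nth by (metis (no_types, lifting) mult.commute times_divide_eq_right divide_divide_eq_left)
  then show "fps_nth (fps_const c * hyp2F1 a b c) n =
      fps_nth (fps_X * fps_deriv (hyp2F1 a b (c + 1)) + fps_const c * hyp2F1 a b (c + 1)) n"
    by (cases n) (simp_all add: distrib_right)
qed

lemma hyp2F1_raise_denominator:
  assumes "\<And>n. c + of_nat n \<noteq> 0"
  shows "fps_const ((c - a) * (c - b)) * hyp2F1 a b (c + 1) =
    fps_const c * ((1 - fps_X) * fps_deriv (hyp2F1 a b c) + fps_const (c - a - b) * hyp2F1 a b c)"
    (is "?L = ?R")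
proof (rule fps_ext)
  fix n
  define f where "f = fps_nth (hyp2F1 a b c) n"
  define N where "N = (of_nat n :: complex)"
  have nz: "c + N \<noteq> 0" "N + 1 \<noteq> 0"
    using assms[of n] of_nat_plus_1_neq_0[of n] by (simp_all add: N_def)
  have p: "pochhammer c n \<noteq> 0" "pochhammer (c + 1) n \<noteq> 0"
  proof -
    show "pochhammer c n \<noteq> 0" by (rule pochhammer_nonzero[OF assms])
    have "c + 1 + of_nat m \<noteq> 0" for m using assms[of "Suc m"] by (simp add: add_ac)
    then show "pochhammer (c + 1) n \<noteq> 0" by (rule pochhammer_nonzero)
  qed
  have "c * pochhammer (c + 1) n = (c + N) * pochhammer c n"
    using pochhammer_rec[of c n] pochhammer_Suc[of c n] by (simp add: mult_ac add_ac N_def)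
  then have "1 / pochhammer (c + 1) n = c / (c + N) / pochhammer c n"
    using p nz by (simp add: divide_simps)
  then have F: "fps_nth (hyp2F1 a b (c + 1)) n = f * (c / (c + N))"
    unfolding hyp2F1_nth f_def by (metis (no_types, lifting) mult.commute mult.left_commute mult.right_neutral times_divide_eq_right divide_divide_eq_left)
  have f1: "(N + 1) * fps_nth (hyp2F1 a b c) (Suc n) = f * ((a + N) * (b + N) / (c + N))"
  proof -
    have "fps_nth (hyp2F1 a b c) (Suc n) = f * ((a + N) * (b + N) / ((c + N) * (N + 1)))"
      unfolding hyp2F1_nth_Suc f_def N_def by (simp add: add_ac)
    then show ?thesis using nz by (simp add: divide_simps mult_ac)
  qed
  have "fps_nth ?R n = c * ((N + 1) * fps_nth (hyp2F1 a b c) (Suc n) - N * f + (c - a - b) * f)"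
    by (cases n) (simp_all add: f_def N_def algebra_simps)
  also have "\<dots> = (c - a) * (c - b) * (f * (c / (c + N)))"
    unfolding f1 using nz by (simp add: divide_simps) algebra
  finally show "fps_nth ?L n = fps_nth ?R n" by (simp add: F)
qed

lemma nonint_add_of_nat: "c \<notin> \<int> \<Longrightarrow> c + of_nat n \<noteq> (0 :: complex)"
  by (metis Ints_of_nat Ints_minus add_eq_0_iff2 add.commute eq_neg_iff_add_eq_0)

lemma algebraic_hyp2F1_shift_a:
  assumes "a \<notin> \<int>" "c \<notin> \<int>" "c - a \<notin> \<int>"
  shows "algebraic_fps (hyp2F1 (a + 1) b c) \<longleftrightarrow> algebraic_fps (hyp2F1 a b c)"
proof
  assume F: "algebraic_fps (hyp2F1 a b c)"
  have nz: "fps_const a \<noteq> 0" using assms by auto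
  show "algebraic_fps (hyp2F1 (a + 1) b c)"
    by (rule algebraic_fps_divide[OF nz algebraic_fps_const], unfold hyp2F1_raise)
       (intro algebraic_fps_intros algebraic_fps_deriv F)
next
  assume F: "algebraic_fps (hyp2F1 (a + 1) b c)"
  have "c - a - 1 \<noteq> 0" using assms by auto
  then have nz: "fps_const (c - a - 1) \<noteq> 0" by (simp del: fps_const_sub)
  show "algebraic_fps (hyp2F1 a b c)"
    by (rule algebraic_fps_divide[OF nz algebraic_fps_const],
        unfold hyp2F1_lower[OF nonint_add_of_nat[OF assms(2)]])
       (intro algebraic_fps_intros algebraic_fps_deriv F)
qed

lemma algebraic_hyp2F1_shift_c:
  assumes "c \<notin> \<int>" "c - a \<notin> \<int>" "c - b \<notin> \<int>"
  shows "algebraic_fps (hyp2F1 a b (c + 1)) \<longleftrightarrow> algebraic_fps (hyp2F1 a b c)"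
proof
  assume F: "algebraic_fps (hyp2F1 a b (c + 1))"
  have nz: "fps_const c \<noteq> 0" using assms by auto
  show "algebraic_fps (hyp2F1 a b c)"
    by (rule algebraic_fps_divide[OF nz algebraic_fps_const],
        unfold hyp2F1_lower_denominator[OF nonint_add_of_nat[OF assms(1)]])
       (intro algebraic_fps_intros algebraic_fps_deriv F)
next
  assume F: "algebraic_fps (hyp2F1 a b c)"
  have "(c - a) * (c - b) \<noteq> 0" using assms by auto
  then have nz: "fps_const ((c - a) * (c - b)) \<noteq> 0"
    by (simp del: fps_const_mult fps_const_sub mult_eq_0_iff)
  show "algebraic_fps (hyp2F1 a b (c + 1))"
    by (rule algebraic_fps_divide[OF nz algebraic_fps_const],
        unfold hyp2F1_raise_denominator[OF nonint_add_of_nat[OF assms(1)]])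
       (intro algebraic_fps_intros algebraic_fps_deriv F)
qed

lemma int_shift_invariant:
  assumes "\<And>i :: int. P (a + of_int i + 1) \<longleftrightarrow> P (a + of_int i)"
  shows "P (a + of_int i) \<longleftrightarrow> P (a :: complex)"
proof (induction i rule: int_induct[where k = 0])
  case (step1 i)
  then show ?case using assms[of i] by (simp add: add_ac)
next
  case (step2 i)
  then show ?case using assms[of "i - 1"] by simp
qed simp

lemma nonint_shift: "(x :: complex) + of_int i \<in> \<int> \<longleftrightarrow> x \<in> \<int>"
  by (metis Ints_add Ints_diff Ints_of_int add_diff_cancel_right')

lemma algebraic_hyp2F1_shift:
  assumes ni: "a \<notin> \<int>" "b \<notin> \<int>" "c \<notin> \<int>" "c - a \<notin> \<int>" "c - b \<notin> \<int>"
    and "algebraic_fps (hyp2F1 a b c)"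
  shows "algebraic_fps (hyp2F1 (a + of_int i) (b + of_int j) (c + of_int k))"
proof -
  have d: "c - (a + of_int i) \<notin> \<int>" "c - (b + of_int j) \<notin> \<int>"
      "c + of_int k - (a + of_int i) \<notin> \<int>" "c + of_int k - (b + of_int j) \<notin> \<int>" for i j k
    using nonint_shift[of "c - a" "- i"] nonint_shift[of "c - b" "- j"]
      nonint_shift[of "c - a" "k - i"] nonint_shift[of "c - b" "k - j"] ni
    by (simp_all add: algebra_simps)
  have "algebraic_fps (hyp2F1 (a + of_int i) b c) \<longleftrightarrow> algebraic_fps (hyp2F1 a b c)"
    by (rule int_shift_invariant[where P = "\<lambda>a. algebraic_fps (hyp2F1 a b c)"],
        rule algebraic_hyp2F1_shift_a) (use ni d in \<open>simp_all add: nonint_shift\<close>)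
  moreover have "algebraic_fps (hyp2F1 (a + of_int i) (b + of_int j) c) \<longleftrightarrow>
      algebraic_fps (hyp2F1 (a + of_int i) b c)"
    unfolding hyp2F1_commute[of "a + of_int i"]
    by (rule int_shift_invariant[where P = "\<lambda>b. algebraic_fps (hyp2F1 b (a + of_int i) c)"],
        rule algebraic_hyp2F1_shift_a) (use ni d in \<open>simp_all add: nonint_shift\<close>)
  moreover have "algebraic_fps (hyp2F1 (a + of_int i) (b + of_int j) (c + of_int k)) \<longleftrightarrow>
      algebraic_fps (hyp2F1 (a + of_int i) (b + of_int j) c)"
    by (rule int_shift_invariant[where P = "\<lambda>c. algebraic_fps (hyp2F1 (a + of_int i) (b + of_int j) c)"],
        rule algebraic_hyp2F1_shift_c) (use ni d in \<open>simp_all add: nonint_shift\<close>)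
  ultimately show ?thesis using assms(6) by simp
qed

section \<open>Algebraic pullbacks of the hypergeometric equation\<close>

text \<open>
  The hypergeometric equation determines each coefficient from its predecessor, because \<open>c\<close> is not a
  nonpositive integer.
\<close>

lemma hyp2F1_unique:
  assumes c: "\<And>n. c + of_nat n \<noteq> 0" and f0: "fps_nth f 0 = 1"
    and ode: "fps_X * (1 - fps_X) * fps_deriv (fps_deriv f)
      + (fps_const c - fps_const (a + b + 1) * fps_X) * fps_deriv f - fps_const (a * b) * f = 0" (is "?E = 0")
  shows "f = hyp2F1 a b c"
proof (rule fps_ext)
  have E: "?E = fps_X * fps_deriv (fps_deriv f) - fps_X * (fps_X * fps_deriv (fps_deriv f))
      + fps_const c * fps_deriv f - fps_const (a + b + 1) * (fps_X * fps_deriv f) - fps_const (a * b) * f"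
    by (simp add: algebra_simps)
  have rec: "of_nat (Suc n) * (c + of_nat n) * fps_nth f (Suc n) = (a + of_nat n) * (b + of_nat n) * fps_nth f n" for n
  proof -
    have "fps_nth ?E n = of_nat (Suc n) * (c + of_nat n) * fps_nth f (Suc n) - (a + of_nat n) * (b + of_nat n) * fps_nth f n"
    proof -
      consider "n = 0" | "n = Suc 0" | m where "n = Suc (Suc m)" by (metis not0_implies_Suc)
      then show ?thesis unfolding E by cases (simp_all add: algebra_simps)
    qed
    then show ?thesis unfolding ode by simp
  qed
  show "fps_nth f n = fps_nth (hyp2F1 a b c) n" for n
  proof (induction n)
    case 0
    then show ?case by (simp add: f0 hyp2F1_nth)
  next
    case (Suc n)
    have nz: "of_nat (Suc n) * (c + of_nat n) \<noteq> 0" using c[of n] of_nat_neq_0 by simp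
    then have "fps_nth f (Suc n) = (a + of_nat n) * (b + of_nat n) * fps_nth f n / (of_nat (Suc n) * (c + of_nat n))"
      using rec[of n] by (simp add: eq_divide_eq mult_ac del: of_nat_Suc)
    then show ?case unfolding hyp2F1_nth_Suc Suc by (simp add: mult_ac)
  qed
qed

lemma poly_map_fps_const: "fps_nth s 0 = 0 \<Longrightarrow> poly (map_poly fps_const P) s = fps_of_poly P oo (s :: complex fps)"
  by (induction P)
     (simp_all add: map_poly_pCons fps_of_poly_pCons fps_compose_add_distrib fps_compose_mult_distrib mult.commute)

text \<open>
  Let \<open>\<phi> = N / D\<close> and let \<open>h\<close> have logarithmic derivative \<open>P / Q\<close>. If \<open>h\<close> is the pullback \<open>F \<circ> \<phi>\<close>,
  then \<open>w = h' / (\<phi>' h) = A / B\<close> is the pullback of \<open>F' / F\<close>, and the last assumption is the Riccati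
  form of the hypergeometric equation, with \<open>\<phi>' = U / V\<close> and with the coefficients of the equation
  scaled by \<open>k\<close> to become integral in applications. Conversely, these polynomial identities show
  that \<open>h \<circ> \<phi>\<^sup>-\<^sup>1\<close> solves the equation, so it is \<open>F\<close>; and it is algebraic because \<open>\<phi>\<^sup>-\<^sup>1\<close> is.
\<close>

lemma algebraic_hyp2F1_pullback:
  fixes N D P Q A B U V C S T :: "complex poly" and h :: "complex fps"
  assumes N0: "poly N 0 = 0" "poly (pderiv N) 0 \<noteq> 0" and D0: "poly D 0 = 1"
    and nz0: "poly Q 0 \<noteq> 0" "poly B 0 \<noteq> 0" "poly U 0 \<noteq> 0" "poly V 0 \<noteq> 0" "k \<noteq> 0"
    and h: "fps_nth h 0 = 1" "algebraic_fps h" "fps_of_poly Q * fps_deriv h = fps_of_poly P * h"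
    and \<phi>': "V * (pderiv N * D - N * pderiv D) = U * D ^ 2"
    and w: "V * B * P = A * U * Q"
    and coeffs: "C = [:k * c:]" "S = [:k * (a + b + 1):]" "T = [:k * (a * b):]"
    and c: "\<And>n. c + of_nat n \<noteq> 0"
    and riccati: "[:k:] * (N * (D - N) * ((pderiv A * B - A * pderiv B) * V + A ^ 2 * U))
       + (C * D - S * N) * D * A * B * U - T * B ^ 2 * U * D ^ 2 = 0"
  shows "algebraic_fps (hyp2F1 a b c)"
proof -
  have N: "coeff N 0 = 0" "coeff N 1 \<noteq> 0" and D: "coeff D 0 = 1"
    using N0 D0 by (simp_all add: poly_0_coeff_0 coeff_pderiv)
  have nz: "Q \<noteq> 0" "B \<noteq> 0" "U \<noteq> 0" "V \<noteq> 0" "k \<noteq> 0"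
    using nz0 by auto
  define \<phi> where "\<phi> = fps_of_poly N * inverse (fps_of_poly D)"
  have D\<phi>: "fps_of_poly D * \<phi> = fps_of_poly N"
    using D by (simp add: \<phi>_def inverse_mult_eq_1' mult.left_commute)
  have \<phi>0: "fps_nth \<phi> 0 = 0" using N by (simp add: \<phi>_def)
  have \<phi>1: "fps_nth \<phi> 1 \<noteq> 0"
    using N D arg_cong[OF D\<phi>, of "\<lambda>f. fps_nth f 1"] by (simp add: fps_mult_nth \<phi>0)
  define s where "s = fps_inv \<phi>"
  have s0: "fps_nth s 0 = 0" by (simp add: s_def fps_inv_def)
  have \<phi>s: "\<phi> oo s = fps_X" unfolding s_def by (rule fps_inv_right[OF \<phi>0 \<phi>1])
  have s\<phi>: "s oo \<phi> = fps_X" unfolding s_def by (rule fps_inv[OF \<phi>0 \<phi>1])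
  have "algebraic_fps s"
  proof (rule algebraic_fps_trans)
    let ?p = "map_poly fps_const N - smult fps_X (map_poly fps_const D)"
    have "fps_nth (coeff ?p 1) 0 \<noteq> 0" using N by (simp add: coeff_map_poly)
    then show "?p \<noteq> 0" by auto
    show "algebraic_fps (coeff ?p i)" for i
      by (auto simp: coeff_map_poly intro!: algebraic_fps_intros)
    have "(fps_of_poly D * \<phi>) oo s = fps_of_poly N oo s" by (simp only: D\<phi>)
    then show "poly ?p s = 0"
      by (simp add: poly_map_fps_const s0 fps_compose_mult_distrib \<phi>s mult.commute)
  qed
  define f where "f = h oo s"
  have alg: "algebraic_fps f"
    using algebraic_fps_compose[OF h(2) \<open>algebraic_fps s\<close> s0] by (simp add: fps_lift_complex f_def)
  have f\<phi>: "f oo \<phi> = h"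
    unfolding f_def by (subst fps_compose_assoc[symmetric]) (simp_all add: \<phi>0 s0 s\<phi>)
  define f1 where "f1 = fps_deriv f oo \<phi>"
  define f2 where "f2 = fps_deriv (fps_deriv f) oo \<phi>"
  have h': "fps_deriv h = f1 * fps_deriv \<phi>"
    unfolding f\<phi>[symmetric] f1_def by (rule fps_compose_deriv[OF \<phi>0])
  have f1': "fps_deriv f1 = f2 * fps_deriv \<phi>"
    unfolding f1_def f2_def by (rule fps_compose_deriv[OF \<phi>0])
  let ?p = "fps_of_poly :: complex poly \<Rightarrow> complex fps"
  note p_simps = fps_of_poly_add fps_of_poly_diff fps_of_poly_mult fps_of_poly_power fps_of_poly_pderiv
     fps_of_poly_const
  have inj: "?p R \<noteq> 0" if "R \<noteq> 0" for R using that fps_of_poly_eq_iff[of R 0] by simp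
  have Dn: "?p D \<noteq> 0" using D by (intro inj) auto
  have \<phi>'n: "fps_deriv \<phi> \<noteq> 0"
    using \<phi>1 by (metis One_nat_def fps_deriv_nth fps_zero_nth add_0 mult_cancel_right1 of_nat_1)
  have d\<phi>: "?p V * fps_deriv \<phi> = ?p U"
  proof -
    have 1: "fps_deriv (?p D) * \<phi> + ?p D * fps_deriv \<phi> = fps_deriv (?p N)"
      using arg_cong[OF D\<phi>, of fps_deriv] by (simp add: algebra_simps)
    have 2: "?p V * (fps_deriv (?p N) * ?p D - ?p N * fps_deriv (?p D)) = ?p U * ?p D ^ 2"
      using arg_cong[OF \<phi>', of ?p] by (simp only: p_simps)
    have "?p D ^ 2 * (?p V * fps_deriv \<phi>) = ?p V * (?p D * (fps_deriv (?p N) - fps_deriv (?p D) * \<phi>))"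
      unfolding 1[symmetric] by (simp add: power2_eq_square mult_ac)
    also have "\<dots> = ?p V * (fps_deriv (?p N) * ?p D - ?p N * fps_deriv (?p D))"
      unfolding D\<phi>[symmetric] by (simp add: algebra_simps)
    also have "\<dots> = ?p D ^ 2 * ?p U"
      unfolding 2 by (rule mult.commute)
    finally have "?p D ^ 2 * (?p V * fps_deriv \<phi>) = ?p D ^ 2 * ?p U" .
    then show ?thesis using Dn by simp
  qed
  have Bf1: "?p B * f1 = ?p A * h"
  proof -
    have w': "?p V * ?p B * ?p P = ?p A * ?p U * ?p Q"
      using arg_cong[OF w, of ?p] by (simp only: p_simps)
    have "?p Q * ?p V * fps_deriv \<phi> * (?p B * f1) = ?p V * ?p B * (?p Q * fps_deriv h)"
      unfolding h' by (simp add: mult_ac)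
    also have "\<dots> = ?p V * ?p B * ?p P * h"
      unfolding h(3) by (simp add: mult_ac)
    also have "\<dots> = ?p Q * ?p V * fps_deriv \<phi> * (?p A * h)"
      unfolding w' d\<phi>[symmetric] by (simp add: mult_ac)
    finally have "?p Q * ?p V * fps_deriv \<phi> * (?p B * f1) = ?p Q * ?p V * fps_deriv \<phi> * (?p A * h)" .
    then show ?thesis using inj nz \<phi>'n by simp
  qed
  have Bf2: "?p B ^ 2 * ?p U * f2 =
      ((fps_deriv (?p A) * ?p B - ?p A * fps_deriv (?p B)) * ?p V + ?p A ^ 2 * ?p U) * h"
  proof -
    have "fps_deriv (?p B) * f1 + ?p B * (f2 * fps_deriv \<phi>) = fps_deriv (?p A) * h + ?p A * (f1 * fps_deriv \<phi>)"
      using arg_cong[OF Bf1, of fps_deriv] by (simp add: f1' h' algebra_simps)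
    then have e: "?p B * (f2 * fps_deriv \<phi>) = fps_deriv (?p A) * h + ?p A * (f1 * fps_deriv \<phi>) - fps_deriv (?p B) * f1"
      by (simp add: algebra_simps)
    have "?p B ^ 2 * ?p U * f2 = ?p B * ?p V * (?p B * (f2 * fps_deriv \<phi>))"
      unfolding d\<phi>[symmetric] by (simp add: power2_eq_square mult_ac)
    also have "\<dots> = ?p V * fps_deriv (?p A) * ?p B * h + ?p A * (?p B * f1) * (?p V * fps_deriv \<phi>)
        - ?p V * fps_deriv (?p B) * (?p B * f1)"
      unfolding e by (simp add: algebra_simps)
    also have "\<dots> = ((fps_deriv (?p A) * ?p B - ?p A * fps_deriv (?p B)) * ?p V + ?p A ^ 2 * ?p U) * h"
      unfolding Bf1 d\<phi> by (simp add: algebra_simps power2_eq_square)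
    finally show ?thesis .
  qed
  let ?k = "fps_const k" and ?c = "fps_const c" and ?s = "fps_const (a + b + 1)" and ?t = "fps_const (a * b)"
  have id: "?k * (?p N * (?p D - ?p N) * ((fps_deriv (?p A) * ?p B - ?p A * fps_deriv (?p B)) * ?p V + ?p A ^ 2 * ?p U))
       + (?k * ?c * ?p D - ?k * ?s * ?p N) * ?p D * ?p A * ?p B * ?p U - ?k * ?t * ?p B ^ 2 * ?p U * ?p D ^ 2 = 0"
    using arg_cong[OF riccati, of ?p]
    unfolding p_simps coeffs fps_of_poly_0 fps_const_mult[symmetric] .
  let ?G = "fps_X * (1 - fps_X) * fps_deriv (fps_deriv f) + (?c - ?s * fps_X) * fps_deriv f - ?t * f"
  have G: "?G oo \<phi> = \<phi> * (1 - \<phi>) * f2 + (?c - ?s * \<phi>) * f1 - ?t * h"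
    by (simp add: fps_compose_add_distrib fps_compose_sub_distrib fps_compose_mult_distrib \<phi>0
        f1_def f2_def f\<phi> del: fps_const_add fps_const_mult)
  have "?k * (?p D ^ 2 * (?p B ^ 2 * ?p U)) * (\<phi> * (1 - \<phi>) * f2 + (?c - ?s * \<phi>) * f1 - ?t * h) = 0"
  proof -
    let ?W = "(fps_deriv (?p A) * ?p B - ?p A * fps_deriv (?p B)) * ?p V + ?p A ^ 2 * ?p U"
    have "?k * (?p D ^ 2 * (?p B ^ 2 * ?p U)) * (\<phi> * (1 - \<phi>) * f2 + (?c - ?s * \<phi>) * f1 - ?t * h) =
        ?k * ((?p D * \<phi>) * (?p D - ?p D * \<phi>) * (?p B ^ 2 * ?p U * f2))
        + (?k * ?c * ?p D - ?k * ?s * (?p D * \<phi>)) * ?p D * ?p B * ?p U * (?p B * f1)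
        - ?k * ?t * ?p B ^ 2 * ?p U * ?p D ^ 2 * h"
      by algebra
    also have "\<dots> = (?k * (?p N * (?p D - ?p N) * ?W)
        + (?k * ?c * ?p D - ?k * ?s * ?p N) * ?p D * ?p A * ?p B * ?p U - ?k * ?t * ?p B ^ 2 * ?p U * ?p D ^ 2) * h"
      unfolding D\<phi> Bf1 Bf2 by algebra
    finally show ?thesis unfolding id by simp
  qed
  then have "?G oo \<phi> = 0"
    unfolding G using Dn inj nz by (simp del: fps_const_add fps_const_mult)
  then have "?G = 0"
    using fps_compose_eq_0_iff[OF \<phi>0, of ?G] \<phi>1 by auto
  then have "f = hyp2F1 a b c"
    by (intro hyp2F1_unique c) (simp_all add: f_def h)
  then show ?thesis using alg by simp
qed

section \<open>Tetrahedral and octahedral hypergeometric functions\<close>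

definition poly_pow :: "complex \<Rightarrow> complex poly \<Rightarrow> complex fps" where
  "poly_pow e p = fps_pow e (fps_of_poly p - 1)"

lemma poly_pow_nth_0: "fps_nth (poly_pow e p) 0 = 1"
  by (simp add: poly_pow_def)

lemma algebraic_poly_pow: "poly p 0 = 1 \<Longrightarrow> e \<in> \<rat> \<Longrightarrow> algebraic_fps (poly_pow e p)"
  unfolding poly_pow_def
  by (intro algebraic_fps_pow algebraic_fps_intros) (simp_all add: poly_0_coeff_0)

lemma poly_pow_deriv:
  assumes "poly p 0 = 1" "M = [:e:] * K"
  shows "fps_of_poly (K * p) * fps_deriv (poly_pow e p) = fps_of_poly (M * pderiv p) * poly_pow e p"
proof -
  have "fps_nth (fps_of_poly p - 1) 0 = 0" using assms(1) by (simp add: poly_0_coeff_0)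
  from fps_pow_deriv[OF this, of e] show ?thesis
    unfolding assms(2)
    by (simp add: poly_pow_def of_cx_fps_def of_cx_complex_def fps_of_poly_mult fps_of_poly_pderiv
        fps_of_poly_const fps_of_poly_smult mult_ac)
qed

lemma log_deriv_mult:
  fixes f g :: "complex fps"
  assumes "fps_of_poly Q * fps_deriv f = fps_of_poly P * f" "fps_of_poly Q' * fps_deriv g = fps_of_poly P' * g"
  shows "fps_of_poly (Q * Q') * fps_deriv (f * g) = fps_of_poly (P * Q' + P' * Q) * (f * g)"
proof -
  have "fps_of_poly (Q * Q') * fps_deriv (f * g) =
      fps_of_poly Q' * g * (fps_of_poly Q * fps_deriv f) + fps_of_poly Q * f * (fps_of_poly Q' * fps_deriv g)"
    by (simp add: fps_of_poly_mult algebra_simps)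
  then show ?thesis unfolding assms by (simp add: fps_of_poly_mult fps_of_poly_add algebra_simps)
qed

lemma pderiv_power_numeral:
  "pderiv (p ^ numeral k) = numeral k * p ^ pred_numeral k * pderiv p"
  for p :: "'a :: idom poly"
proof -
  have "pderiv (p ^ Suc m) = of_nat (Suc m) * p ^ m * pderiv p" for m
    unfolding pderiv_power_Suc by (simp add: of_nat_poly)
  from this[of "pred_numeral k"] show ?thesis
    by (simp add: numeral_eq_Suc[symmetric] del: power_Suc)
qed

lemma nonint: "n * x = of_int j \<Longrightarrow> n = of_int m \<Longrightarrow> \<not> m dvd j \<Longrightarrow> x \<notin> \<int>" for x :: complex
  by (metis Ints_cases dvd_triv_left of_int_eq_iff of_int_mult)

lemma pderiv_linear_var: "pderiv [:0, 1 :: complex:] = 1"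
  by (simp add: pderiv_pCons)

lemmas pderiv_rules = pderiv_add pderiv_diff pderiv_minus pderiv_mult pderiv_power_numeral
  pderiv_numeral pderiv_1 pred_numeral_simps BitM.simps numeral_One power_one_right

text \<open>
  The exponent differences of the hypergeometric equation at \<open>0, 1, \<infinity>\<close> are \<open>1/3, 1/3, 2/3\<close> here. The
  covering \<open>\<phi> = N / D\<close> of degree \<open>4\<close> has one simple and one triple point over each of \<open>0, 1, \<infinity>\<close>; note
  \<open>D - N = (1 - 2 x)\<^sup>3 (1 + 2 x)\<close>. It resolves the singularities so far that one solution of the
  pulled back equation becomes a power of a rational function.
\<close>

lemma algebraic_tetrahedral_1: "algebraic_fps (hyp2F1 (1 / 2) (- 1 / 6) (2 / 3))"
proof -
  define x :: "complex poly" where "x = [:0, 1:]"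
  have x0: "poly x 0 = 0" and dx: "pderiv x = 1" by (simp_all add: x_def pderiv_linear_var)
  note rules = pderiv_rules dx
  let ?N = "16 * x * (1 + x) ^ 3"
  let ?D = "(1 + 4 * x) ^ 3"
  let ?U = "16 * (1 + x) ^ 2 * (1 - 2 * x) ^ 2"
  let ?V = "(1 + 4 * x) ^ 4"
  let ?A = "- ((1 + 4 * x) ^ 3)"
  let ?B = "(8 * (1 + x) ^ 2 * (1 - 2 * x) ^ 2)"
  let ?l1 = "1 + 4 * x" and ?h1 = "poly_pow (- 1 / 2) (1 + 4 * x)"
  let ?P = "(- 1) * pderiv ?l1" and ?Q = "2 * ?l1" and ?h = "?h1"
  have l: "poly ?l1 0 = 1" by (simp_all add: x0)
  have d1: "fps_of_poly (2 * ?l1) * fps_deriv ?h1 = fps_of_poly ((- 1) * pderiv ?l1) * ?h1"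
    by (rule poly_pow_deriv[OF l]) (simp add: numeral_poly one_pCons)
  show ?thesis
  proof (rule algebraic_hyp2F1_pullback)
    show "poly ?N 0 = 0" "poly (pderiv ?N) 0 \<noteq> 0" "poly ?D 0 = 1"
      "poly ?Q 0 \<noteq> 0" "poly ?B 0 \<noteq> 0" "poly ?U 0 \<noteq> 0" "poly ?V 0 \<noteq> 0" "(12 :: complex) \<noteq> 0"
      by (simp_all add: x0 rules)
    show "fps_nth (?h) 0 = 1" by (simp add: poly_pow_nth_0)
    show "algebraic_fps (?h)"
      by (intro algebraic_fps_mult algebraic_poly_pow l) simp_all
    show "fps_of_poly (?Q) * fps_deriv (?h) = fps_of_poly (?P) * (?h)"
      by (rule d1)
    show "?V * (pderiv ?N * ?D - ?N * pderiv ?D) = ?U * ?D ^ 2"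
      unfolding rules by algebra
    show "?V * ?B * (?P) = ?A * ?U * (?Q)"
      unfolding rules by algebra
    show "8 = [:12 * (2 / 3) :: complex:]" "16 = [:12 * (1 / 2 + - 1 / 6 + 1) :: complex:]" "(- 1) = [:12 * ((1 / 2) * (- 1 / 6)) :: complex:]"
      by (simp_all add: numeral_poly one_pCons)
    show "2 / 3 + of_nat n \<noteq> (0 :: complex)" for n
      by (rule nonint_add_of_nat, rule nonint[of 3 _ 2 3]) simp_all
    show "[:12:] * (?N * (?D - ?N) * ((pderiv ?A * ?B - ?A * pderiv ?B) * ?V + ?A ^ 2 * ?U))
       + (8 * ?D - 16 * ?N) * ?D * ?A * ?B * ?U - (- 1) * ?B ^ 2 * ?U * ?D ^ 2 = 0"
      unfolding rules numeral_poly[symmetric] by algebra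
  qed
qed

text \<open>
  The second solution of the equation with parameters \<open>a, b, c\<close> at \<open>0\<close> is the product of \<open>z\<close> to the
  power \<open>1 - c\<close>, of \<open>1 - z\<close> to the power \<open>c - a - b\<close> and of the hypergeometric function with parameters
  \<open>1 - a, 1 - b, 2 - c\<close>. After pullback by the same \<open>\<phi>\<close>, its quotient by the first solution is the
  power \<open>1 - c\<close> of a rational function, namely of a multiple of \<open>x (1 + 2 x)\<close>; this yields \<open>h\<close>.
\<close>

lemma algebraic_tetrahedral_1_dual: "algebraic_fps (hyp2F1 (1 / 2) (7 / 6) (4 / 3))"
proof -
  define x :: "complex poly" where "x = [:0, 1:]"
  have x0: "poly x 0 = 0" and dx: "pderiv x = 1" by (simp_all add: x_def pderiv_linear_var)
  note rules = pderiv_rules dx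
  let ?N = "16 * x * (1 + x) ^ 3"
  let ?D = "(1 + 4 * x) ^ 3"
  let ?U = "16 * (1 + x) ^ 2 * (1 - 2 * x) ^ 2"
  let ?V = "(1 + 4 * x) ^ 4"
  let ?A = "((7 + 2 * x + 4 * x ^ 2) * (1 + 4 * x) ^ 3)"
  let ?B = "(16 * (1 + x) ^ 3 * (1 - 2 * x) ^ 3)"
  let ?l1 = "1 + 4 * x" and ?h1 = "poly_pow (3 / 2) (1 + 4 * x)"
  let ?l2 = "(1 + x) * (1 - 2 * x)" and ?h2 = "poly_pow (- 1) ((1 + x) * (1 - 2 * x))"
  let ?P = "(3 * pderiv ?l1) * (1 * ?l2) + ((- 1) * pderiv ?l2) * (2 * ?l1)" and ?Q = "(2 * ?l1) * (1 * ?l2)" and ?h = "?h1 * ?h2"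
  have l: "poly ?l1 0 = 1" "poly ?l2 0 = 1" by (simp_all add: x0)
  have d1: "fps_of_poly (2 * ?l1) * fps_deriv ?h1 = fps_of_poly (3 * pderiv ?l1) * ?h1"
    by (rule poly_pow_deriv[OF l(1)]) (simp add: numeral_poly one_pCons)
  have d2: "fps_of_poly (1 * ?l2) * fps_deriv ?h2 = fps_of_poly ((- 1) * pderiv ?l2) * ?h2"
    by (rule poly_pow_deriv[OF l(2)]) (simp add: numeral_poly one_pCons)
  show ?thesis
  proof (rule algebraic_hyp2F1_pullback)
    show "poly ?N 0 = 0" "poly (pderiv ?N) 0 \<noteq> 0" "poly ?D 0 = 1"
      "poly ?Q 0 \<noteq> 0" "poly ?B 0 \<noteq> 0" "poly ?U 0 \<noteq> 0" "poly ?V 0 \<noteq> 0" "(12 :: complex) \<noteq> 0"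
      by (simp_all add: x0 rules)
    show "fps_nth (?h) 0 = 1" by (simp add: poly_pow_nth_0)
    show "algebraic_fps (?h)"
      by (intro algebraic_fps_mult algebraic_poly_pow l) simp_all
    show "fps_of_poly (?Q) * fps_deriv (?h) = fps_of_poly (?P) * (?h)"
      by (rule log_deriv_mult[OF d1 d2])
    show "?V * (pderiv ?N * ?D - ?N * pderiv ?D) = ?U * ?D ^ 2"
      unfolding rules by algebra
    show "?V * ?B * (?P) = ?A * ?U * (?Q)"
      unfolding rules by algebra
    show "16 = [:12 * (4 / 3) :: complex:]" "32 = [:12 * (1 / 2 + 7 / 6 + 1) :: complex:]" "7 = [:12 * ((1 / 2) * (7 / 6)) :: complex:]"
      by (simp_all add: numeral_poly one_pCons)
    show "4 / 3 + of_nat n \<noteq> (0 :: complex)" for n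
      by (rule nonint_add_of_nat, rule nonint[of 3 _ 4 3]) simp_all
    show "[:12:] * (?N * (?D - ?N) * ((pderiv ?A * ?B - ?A * pderiv ?B) * ?V + ?A ^ 2 * ?U))
       + (16 * ?D - 32 * ?N) * ?D * ?A * ?B * ?U - 7 * ?B ^ 2 * ?U * ?D ^ 2 = 0"
      unfolding rules numeral_poly[symmetric] by algebra
  qed
qed

text \<open>
  Exponent differences \<open>1/3, 1/3, 1/2\<close>, and \<open>D - N = (1 - 8 x)\<^sup>3\<close>: the points over \<open>\<infinity>\<close> are double.
\<close>

lemma algebraic_tetrahedral_2: "algebraic_fps (hyp2F1 (5 / 12) (- 1 / 12) (2 / 3))"
proof -
  define x :: "complex poly" where "x = [:0, 1:]"
  have x0: "poly x 0 = 0" and dx: "pderiv x = 1" by (simp_all add: x_def pderiv_linear_var)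
  note rules = pderiv_rules dx
  let ?N = "64 * x * (1 + x) ^ 3"
  let ?D = "(1 + 20 * x - 8 * x ^ 2) ^ 2"
  let ?U = "64 * (1 + x) ^ 2 * (1 - 8 * x) ^ 2"
  let ?V = "(1 + 20 * x - 8 * x ^ 2) ^ 3"
  let ?A = "- ((5 - 4 * x) * (1 + 20 * x - 8 * x ^ 2) ^ 2)"
  let ?B = "(96 * (1 + x) ^ 2 * (1 - 8 * x) ^ 2)"
  let ?l1 = "1 + 20 * x - 8 * x ^ 2" and ?h1 = "poly_pow (- 1 / 6) (1 + 20 * x - 8 * x ^ 2)"
  let ?P = "(- 1) * pderiv ?l1" and ?Q = "6 * ?l1" and ?h = "?h1"
  have l: "poly ?l1 0 = 1" by (simp_all add: x0)
  have d1: "fps_of_poly (6 * ?l1) * fps_deriv ?h1 = fps_of_poly ((- 1) * pderiv ?l1) * ?h1"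
    by (rule poly_pow_deriv[OF l]) (simp add: numeral_poly one_pCons)
  show ?thesis
  proof (rule algebraic_hyp2F1_pullback)
    show "poly ?N 0 = 0" "poly (pderiv ?N) 0 \<noteq> 0" "poly ?D 0 = 1"
      "poly ?Q 0 \<noteq> 0" "poly ?B 0 \<noteq> 0" "poly ?U 0 \<noteq> 0" "poly ?V 0 \<noteq> 0" "(144 :: complex) \<noteq> 0"
      by (simp_all add: x0 rules)
    show "fps_nth (?h) 0 = 1" by (simp add: poly_pow_nth_0)
    show "algebraic_fps (?h)"
      by (intro algebraic_fps_mult algebraic_poly_pow l) simp_all
    show "fps_of_poly (?Q) * fps_deriv (?h) = fps_of_poly (?P) * (?h)"
      by (rule d1)
    show "?V * (pderiv ?N * ?D - ?N * pderiv ?D) = ?U * ?D ^ 2"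
      unfolding rules by algebra
    show "?V * ?B * (?P) = ?A * ?U * (?Q)"
      unfolding rules by algebra
    show "96 = [:144 * (2 / 3) :: complex:]" "192 = [:144 * (5 / 12 + - 1 / 12 + 1) :: complex:]" "(- 5) = [:144 * ((5 / 12) * (- 1 / 12)) :: complex:]"
      by (simp_all add: numeral_poly one_pCons)
    show "2 / 3 + of_nat n \<noteq> (0 :: complex)" for n
      by (rule nonint_add_of_nat, rule nonint[of 3 _ 2 3]) simp_all
    show "[:144:] * (?N * (?D - ?N) * ((pderiv ?A * ?B - ?A * pderiv ?B) * ?V + ?A ^ 2 * ?U))
       + (96 * ?D - 192 * ?N) * ?D * ?A * ?B * ?U - (- 5) * ?B ^ 2 * ?U * ?D ^ 2 = 0"
      unfolding rules numeral_poly[symmetric] by algebra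
  qed
qed

text \<open>
  As in the previous dual case, with the quotient of the solutions a multiple of \<open>x\<close> to the power \<open>1/3\<close>.
\<close>

lemma algebraic_tetrahedral_2_dual: "algebraic_fps (hyp2F1 (7 / 12) (13 / 12) (4 / 3))"
proof -
  define x :: "complex poly" where "x = [:0, 1:]"
  have x0: "poly x 0 = 0" and dx: "pderiv x = 1" by (simp_all add: x_def pderiv_linear_var)
  note rules = pderiv_rules dx
  let ?N = "64 * x * (1 + x) ^ 3"
  let ?D = "(1 + 20 * x - 8 * x ^ 2) ^ 2"
  let ?U = "64 * (1 + x) ^ 2 * (1 - 8 * x) ^ 2"
  let ?V = "(1 + 20 * x - 8 * x ^ 2) ^ 3"
  let ?A = "((91 - 78 * x + 624 * x ^ 2 + 64 * x ^ 3) * (1 + 20 * x - 8 * x ^ 2) ^ 2)"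
  let ?B = "(192 * (1 + x) ^ 3 * (1 - 8 * x) ^ 3)"
  let ?l1 = "1 + 20 * x - 8 * x ^ 2" and ?h1 = "poly_pow (7 / 6) (1 + 20 * x - 8 * x ^ 2)"
  let ?l2 = "(1 + x) * (1 - 8 * x)" and ?h2 = "poly_pow (- 1) ((1 + x) * (1 - 8 * x))"
  let ?P = "(7 * pderiv ?l1) * (1 * ?l2) + ((- 1) * pderiv ?l2) * (6 * ?l1)" and ?Q = "(6 * ?l1) * (1 * ?l2)" and ?h = "?h1 * ?h2"
  have l: "poly ?l1 0 = 1" "poly ?l2 0 = 1" by (simp_all add: x0)
  have d1: "fps_of_poly (6 * ?l1) * fps_deriv ?h1 = fps_of_poly (7 * pderiv ?l1) * ?h1"
    by (rule poly_pow_deriv[OF l(1)]) (simp add: numeral_poly one_pCons)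
  have d2: "fps_of_poly (1 * ?l2) * fps_deriv ?h2 = fps_of_poly ((- 1) * pderiv ?l2) * ?h2"
    by (rule poly_pow_deriv[OF l(2)]) (simp add: numeral_poly one_pCons)
  show ?thesis
  proof (rule algebraic_hyp2F1_pullback)
    show "poly ?N 0 = 0" "poly (pderiv ?N) 0 \<noteq> 0" "poly ?D 0 = 1"
      "poly ?Q 0 \<noteq> 0" "poly ?B 0 \<noteq> 0" "poly ?U 0 \<noteq> 0" "poly ?V 0 \<noteq> 0" "(144 :: complex) \<noteq> 0"
      by (simp_all add: x0 rules)
    show "fps_nth (?h) 0 = 1" by (simp add: poly_pow_nth_0)
    show "algebraic_fps (?h)"
      by (intro algebraic_fps_mult algebraic_poly_pow l) simp_all
    show "fps_of_poly (?Q) * fps_deriv (?h) = fps_of_poly (?P) * (?h)"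
      by (rule log_deriv_mult[OF d1 d2])
    show "?V * (pderiv ?N * ?D - ?N * pderiv ?D) = ?U * ?D ^ 2"
      unfolding rules by algebra
    show "?V * ?B * (?P) = ?A * ?U * (?Q)"
      unfolding rules by algebra
    show "192 = [:144 * (4 / 3) :: complex:]" "384 = [:144 * (7 / 12 + 13 / 12 + 1) :: complex:]" "91 = [:144 * ((7 / 12) * (13 / 12)) :: complex:]"
      by (simp_all add: numeral_poly one_pCons)
    show "4 / 3 + of_nat n \<noteq> (0 :: complex)" for n
      by (rule nonint_add_of_nat, rule nonint[of 3 _ 4 3]) simp_all
    show "[:144:] * (?N * (?D - ?N) * ((pderiv ?A * ?B - ?A * pderiv ?B) * ?V + ?A ^ 2 * ?U))
       + (192 * ?D - 384 * ?N) * ?D * ?A * ?B * ?U - 91 * ?B ^ 2 * ?U * ?D ^ 2 = 0"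
      unfolding rules numeral_poly[symmetric] by algebra
  qed
qed

text \<open>
  Exponent differences \<open>1/4, 1/4, 2/3\<close>. The covering has degree \<open>6\<close>, with ramification \<open>4 + 1 + 1\<close> over
  \<open>0\<close> and \<open>1\<close>, as \<open>D - N = (1 - 6 x)\<^sup>4 (1 - 3 x)\<close>, and \<open>3 + 3\<close> over \<open>\<infinity>\<close>. It arises from the octahedral
  covering for the exponent differences \<open>1/4, 1/2, 1/3\<close> by the quadratic transformation to \<open>4 z (1 - z)\<close>.
\<close>

lemma algebraic_octahedral: "algebraic_fps (hyp2F1 (7 / 12) (- 1 / 12) (3 / 4))"
proof -
  define x :: "complex poly" where "x = [:0, 1:]"
  have x0: "poly x 0 = 0" and dx: "pderiv x = 1" by (simp_all add: x_def pderiv_linear_var)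
  note rules = pderiv_rules dx
  let ?N = "27 * x * (1 - 2 * x) ^ 4 * (1 - 4 * x)"
  let ?D = "(1 - 12 * x ^ 2) ^ 3"
  let ?U = "27 * (1 - 2 * x) ^ 3 * (1 - 6 * x) ^ 3"
  let ?V = "(1 - 12 * x ^ 2) ^ 4"
  let ?A = "(- 7 + 48 * x - 84 * x ^ 2) * (1 - 12 * x ^ 2) ^ 3"
  let ?B = "(108 * (1 - 2 * x) ^ 3 * (1 - 6 * x) ^ 3 * ((1 - 3 * x) * (1 - 4 * x)))"
  let ?l1 = "1 - 12 * x ^ 2" and ?h1 = "poly_pow (- 1 / 4) (1 - 12 * x ^ 2)"
  let ?l2 = "(1 - 3 * x) * (1 - 4 * x)" and ?h2 = "poly_pow (1 / 4) ((1 - 3 * x) * (1 - 4 * x))"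
  let ?P = "((- 1) * pderiv ?l1) * (4 * ?l2) + (1 * pderiv ?l2) * (4 * ?l1)" and ?Q = "(4 * ?l1) * (4 * ?l2)" and ?h = "?h1 * ?h2"
  have l: "poly ?l1 0 = 1" "poly ?l2 0 = 1" by (simp_all add: x0)
  have d1: "fps_of_poly (4 * ?l1) * fps_deriv ?h1 = fps_of_poly ((- 1) * pderiv ?l1) * ?h1"
    by (rule poly_pow_deriv[OF l(1)]) (simp add: numeral_poly one_pCons)
  have d2: "fps_of_poly (4 * ?l2) * fps_deriv ?h2 = fps_of_poly (1 * pderiv ?l2) * ?h2"
    by (rule poly_pow_deriv[OF l(2)]) (simp add: numeral_poly one_pCons)
  show ?thesis
  proof (rule algebraic_hyp2F1_pullback)
    show "poly ?N 0 = 0" "poly (pderiv ?N) 0 \<noteq> 0" "poly ?D 0 = 1"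
      "poly ?Q 0 \<noteq> 0" "poly ?B 0 \<noteq> 0" "poly ?U 0 \<noteq> 0" "poly ?V 0 \<noteq> 0" "(144 :: complex) \<noteq> 0"
      by (simp_all add: x0 rules)
    show "fps_nth (?h) 0 = 1" by (simp add: poly_pow_nth_0)
    show "algebraic_fps (?h)"
      by (intro algebraic_fps_mult algebraic_poly_pow l) simp_all
    show "fps_of_poly (?Q) * fps_deriv (?h) = fps_of_poly (?P) * (?h)"
      by (rule log_deriv_mult[OF d1 d2])
    show "?V * (pderiv ?N * ?D - ?N * pderiv ?D) = ?U * ?D ^ 2"
      unfolding rules by algebra
    show "?V * ?B * (?P) = ?A * ?U * (?Q)"
      unfolding rules by algebra
    show "108 = [:144 * (3 / 4) :: complex:]" "216 = [:144 * (7 / 12 + - 1 / 12 + 1) :: complex:]" "(- 7) = [:144 * ((7 / 12) * (- 1 / 12)) :: complex:]"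
      by (simp_all add: numeral_poly one_pCons)
    show "3 / 4 + of_nat n \<noteq> (0 :: complex)" for n
      by (rule nonint_add_of_nat, rule nonint[of 4 _ 3 4]) simp_all
    show "[:144:] * (?N * (?D - ?N) * ((pderiv ?A * ?B - ?A * pderiv ?B) * ?V + ?A ^ 2 * ?U))
       + (108 * ?D - 216 * ?N) * ?D * ?A * ?B * ?U - (- 7) * ?B ^ 2 * ?U * ?D ^ 2 = 0"
      unfolding rules numeral_poly[symmetric] by algebra
  qed
qed

text \<open>
  Here the quotient of the solutions is a multiple of \<open>x / ((1 - 3 x) (1 - 4 x))\<close> to the power \<open>1/4\<close>.
\<close>

lemma algebraic_octahedral_dual: "algebraic_fps (hyp2F1 (5 / 12) (13 / 12) (5 / 4))"
proof -
  define x :: "complex poly" where "x = [:0, 1:]"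
  have x0: "poly x 0 = 0" and dx: "pderiv x = 1" by (simp_all add: x_def pderiv_linear_var)
  note rules = pderiv_rules dx
  let ?N = "27 * x * (1 - 2 * x) ^ 4 * (1 - 4 * x)"
  let ?D = "(1 - 12 * x ^ 2) ^ 3"
  let ?U = "27 * (1 - 2 * x) ^ 3 * (1 - 6 * x) ^ 3"
  let ?V = "(1 - 12 * x ^ 2) ^ 4"
  let ?A = "(39 - 520 * x + 2664 * x ^ 2 - 6240 * x ^ 3 + 5616 * x ^ 4) * (1 - 12 * x ^ 2) ^ 3"
  let ?B = "(108 * (1 - 2 * x) ^ 4 * (1 - 6 * x) ^ 4 * ((1 - 3 * x) * (1 - 4 * x)))"
  let ?l1 = "1 - 12 * x ^ 2" and ?h1 = "poly_pow (5 / 4) (1 - 12 * x ^ 2)"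
  let ?l2 = "(1 - 3 * x) * (1 - 4 * x)" and ?h2 = "poly_pow (- 1 / 4) ((1 - 3 * x) * (1 - 4 * x))"
  let ?l3 = "(1 - 2 * x) * (1 - 6 * x)" and ?h3 = "poly_pow (- 1) ((1 - 2 * x) * (1 - 6 * x))"
  let ?P = "((5 * pderiv ?l1) * (4 * ?l2) + ((- 1) * pderiv ?l2) * (4 * ?l1)) * (1 * ?l3) + ((- 1) * pderiv ?l3) * ((4 * ?l1) * (4 * ?l2))" and ?Q = "((4 * ?l1) * (4 * ?l2)) * (1 * ?l3)" and ?h = "?h1 * ?h2 * ?h3"
  have l: "poly ?l1 0 = 1" "poly ?l2 0 = 1" "poly ?l3 0 = 1" by (simp_all add: x0)
  have d1: "fps_of_poly (4 * ?l1) * fps_deriv ?h1 = fps_of_poly (5 * pderiv ?l1) * ?h1"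
    by (rule poly_pow_deriv[OF l(1)]) (simp add: numeral_poly one_pCons)
  have d2: "fps_of_poly (4 * ?l2) * fps_deriv ?h2 = fps_of_poly ((- 1) * pderiv ?l2) * ?h2"
    by (rule poly_pow_deriv[OF l(2)]) (simp add: numeral_poly one_pCons)
  have d3: "fps_of_poly (1 * ?l3) * fps_deriv ?h3 = fps_of_poly ((- 1) * pderiv ?l3) * ?h3"
    by (rule poly_pow_deriv[OF l(3)]) (simp add: numeral_poly one_pCons)
  show ?thesis
  proof (rule algebraic_hyp2F1_pullback)
    show "poly ?N 0 = 0" "poly (pderiv ?N) 0 \<noteq> 0" "poly ?D 0 = 1"
      "poly ?Q 0 \<noteq> 0" "poly ?B 0 \<noteq> 0" "poly ?U 0 \<noteq> 0" "poly ?V 0 \<noteq> 0" "(144 :: complex) \<noteq> 0"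
      by (simp_all add: x0 rules)
    show "fps_nth (?h) 0 = 1" by (simp add: poly_pow_nth_0)
    show "algebraic_fps (?h)"
      by (intro algebraic_fps_mult algebraic_poly_pow l) simp_all
    show "fps_of_poly (?Q) * fps_deriv (?h) = fps_of_poly (?P) * (?h)"
      by (rule log_deriv_mult[OF log_deriv_mult[OF d1 d2] d3])
    show "?V * (pderiv ?N * ?D - ?N * pderiv ?D) = ?U * ?D ^ 2"
      unfolding rules by algebra
    show "?V * ?B * (?P) = ?A * ?U * (?Q)"
      unfolding rules by algebra
    show "180 = [:144 * (5 / 4) :: complex:]" "360 = [:144 * (5 / 12 + 13 / 12 + 1) :: complex:]" "65 = [:144 * ((5 / 12) * (13 / 12)) :: complex:]"
      by (simp_all add: numeral_poly one_pCons)
    show "5 / 4 + of_nat n \<noteq> (0 :: complex)" for n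
      by (rule nonint_add_of_nat, rule nonint[of 4 _ 5 4]) simp_all
    show "[:144:] * (?N * (?D - ?N) * ((pderiv ?A * ?B - ?A * pderiv ?B) * ?V + ?A ^ 2 * ?U))
       + (180 * ?D - 360 * ?N) * ?D * ?A * ?B * ?U - 65 * ?B ^ 2 * ?U * ?D ^ 2 = 0"
      unfolding rules numeral_poly[symmetric] by algebra
  qed
qed

section \<open>The generating functions\<close>

lemma nonint_twelfth: "\<not> 12 dvd j \<Longrightarrow> of_int j / 12 \<notin> (\<int> :: complex set)"
  by (rule nonint[of 12 _ j 12]) simp_all

lemma Ints_pm_iff_residue: "x \<in> Ints_pm a \<longleftrightarrow> x - a \<in> \<int> \<or> x - (1 - a) \<in> \<int>"
proof -
  have "x - (1 - a) = (x + a) + of_int (- 1)" by simp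
  then have "x - (1 - a) \<in> \<int> \<longleftrightarrow> x + a \<in> \<int>" by (simp only: nonint_shift)
  then show ?thesis
    by (auto simp: Ints_pm_def Ints_def algebra_simps)
qed

text \<open>
  The parameters \<open>g, 2 l - g, l + 1/2\<close> are \<open>l + d, l - d, l + 1/2\<close> with \<open>d = g - l\<close>, and \<open>d\<close> may be
  replaced by \<open>- d\<close>. Common denominator \<open>12\<close> suffices for the cases at hand.
\<close>

lemma algebraic_hyp2F1_symmetric:
  fixes p q :: int and l g :: complex
  defines "a \<equiv> of_int (p + q) / 12" and "b \<equiv> of_int (p - q) / 12" and "c \<equiv> of_int (p + 6) / 12"
  assumes F: "algebraic_fps (hyp2F1 a b c)"
    and ni: "\<not> 12 dvd p + q" "\<not> 12 dvd p - q" "\<not> 12 dvd p + 6" "\<not> 12 dvd 6 - q" "\<not> 12 dvd 6 + q"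
    and l: "l - of_int p / 12 \<in> \<int>" and g: "g - l \<in> Ints_pm (of_int q / 12)"
  shows "algebraic_fps (hyp2F1 g (2 * l - g) (l + 1 / 2))"
proof -
  obtain i where i: "l = of_int p / 12 + of_int i" using l by (auto simp: Ints_def diff_eq_eq add.commute)
  have c: "l + 1 / 2 = c + of_int i" by (simp add: i c_def add_divide_distrib)
  have "c - a = of_int (6 - q) / 12" "c - b = of_int (6 + q) / 12"
    by (simp_all add: a_def b_def c_def diff_divide_distrib add_divide_distrib)
  then have ni': "a \<notin> \<int>" "b \<notin> \<int>" "c \<notin> \<int>" "c - a \<notin> \<int>" "c - b \<notin> \<int>"
    using nonint_twelfth[OF ni(1)] nonint_twelfth[OF ni(2)] nonint_twelfth[OF ni(3)]
      nonint_twelfth[OF ni(4)] nonint_twelfth[OF ni(5)]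
    by (simp_all only: a_def b_def c_def not_False_eq_True)
  obtain m where "g - l = of_int m + of_int q / 12 \<or> g - l = of_int m - of_int q / 12"
    using g unfolding Ints_pm_def by blast
  then show ?thesis
  proof
    assume m: "g - l = of_int m + of_int q / 12"
    have "g = a + of_int (i + m)" "2 * l - g = b + of_int (i - m)"
      using m i by (simp_all add: a_def b_def diff_eq_eq add_divide_distrib diff_divide_distrib)
    then show ?thesis
      unfolding c using algebraic_hyp2F1_shift[OF ni' F] by metis
  next
    assume m: "g - l = of_int m - of_int q / 12"
    have "g = b + of_int (i + m)" "2 * l - g = a + of_int (i - m)"
      using m i by (simp_all add: a_def b_def diff_eq_eq add_divide_distrib diff_divide_distrib)
    then show ?thesis
      unfolding c using algebraic_hyp2F1_shift[OF ni' F] hyp2F1_commute by metis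
  qed
qed

lemma algebraic_hyp2F1_gegenbauer:
  assumes "(l \<in> Ints_pm (1/4) \<and> g - l \<in> Ints_pm (1/3)) \<or>
           (l \<in> Ints_pm (1/6) \<and> g - l \<in> Ints_pm (1/3) \<union> Ints_pm (1/4))"
  shows "algebraic_fps (hyp2F1 g (2 * l - g) (l + 1 / 2))"
proof -
  consider "l - 3 / 12 \<in> \<int>" "g - l \<in> Ints_pm (4 / 12)" | "l - 9 / 12 \<in> \<int>" "g - l \<in> Ints_pm (4 / 12)"
    | "l - 2 / 12 \<in> \<int>" "g - l \<in> Ints_pm (4 / 12)" | "l - 10 / 12 \<in> \<int>" "g - l \<in> Ints_pm (4 / 12)"
    | "l - 2 / 12 \<in> \<int>" "g - l \<in> Ints_pm (3 / 12)" | "l - 10 / 12 \<in> \<int>" "g - l \<in> Ints_pm (3 / 12)"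
    using assms unfolding Ints_pm_iff_residue[of l] by fastforce
  then show ?thesis
  proof cases
    case 1
    then show ?thesis
      using algebraic_octahedral by (intro algebraic_hyp2F1_symmetric[of 3 4]) simp_all
  next
    case 2
    then show ?thesis
      using algebraic_octahedral_dual hyp2F1_commute[of "13 / 12"]
      by (intro algebraic_hyp2F1_symmetric[of 9 4]) simp_all
  next
    case 3
    then show ?thesis
      using algebraic_tetrahedral_1 by (intro algebraic_hyp2F1_symmetric[of 2 4]) simp_all
  next
    case 4
    then show ?thesis
      using algebraic_tetrahedral_1_dual hyp2F1_commute[of "7 / 6"]
      by (intro algebraic_hyp2F1_symmetric[of 10 4]) simp_all
  next
    case 5
    then show ?thesis
      using algebraic_tetrahedral_2 by (intro algebraic_hyp2F1_symmetric[of 2 3]) simp_all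
  next
    case 6
    then show ?thesis
      using algebraic_tetrahedral_2_dual hyp2F1_commute[of "13 / 12"]
      by (intro algebraic_hyp2F1_symmetric[of 10 3]) simp_all
  qed
qed

theorem theorem1p13:
  fixes l g :: complex
  assumes "(l \<in> Ints_pm (1/4) \<and> g - l \<in> Ints_pm (1/3)) \<or>
           (l \<in> Ints_pm (1/6) \<and> g - l \<in> Ints_pm (1/3) \<union> Ints_pm (1/4))"
  shows "algebraic_fps (gegenbauer_series1 l g) \<and> algebraic_fps (gegenbauer_series2 l g)"
proof -
  obtain i j :: int where l: "l = of_int (12 * i + j) / 12" and j: "j = 3 \<or> j = - 3 \<or> j = 2 \<or> j = - 2"
  proof -
    obtain i :: int where "l = of_int i + 1/4 \<or> l = of_int i - 1/4 \<or> l = of_int i + 1/6 \<or> l = of_int i - 1/6"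
      using assms unfolding Ints_pm_def by blast
    then show thesis
      using that[of i 3] that[of i "- 3"] that[of i 2] that[of i "- 2"]
      by (auto simp: add_divide_distrib diff_divide_distrib)
  qed
  have "l + 1 / 2 = of_int (12 * i + j + 6) / 12" by (simp add: l add_divide_distrib)
  moreover have "\<not> 12 dvd 12 * i + j + 6" using j by presburger
  ultimately have "l + 1 / 2 \<notin> \<int>" using nonint_twelfth by metis
  then have c: "of_nat k + l + 1 / 2 \<noteq> 0" for k
    using nonint_add_of_nat[of "l + 1 / 2" k] by (simp add: add_ac)
  have "2 * l = of_int (2 * (12 * i + j)) / 12" by (simp add: l)
  moreover have "\<not> 12 dvd 2 * (12 * i + j)" using j by presburger
  ultimately have "2 * l \<notin> \<int>" using nonint_twelfth by metis
  then have d: "of_nat k + 2 * l \<noteq> 0" for k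
    using nonint_add_of_nat[of "2 * l" k] by (simp add: add_ac)
  have "l \<in> \<rat>" by (simp add: l)
  then show ?thesis
    using algebraic_gegenbauer_series1[OF c d] algebraic_gegenbauer_series2[OF c d]
      algebraic_hyp2F1_gegenbauer[OF assms] by blast
qed

end
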